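(* For every $n \ge 1$, the absolute orders on the Coxeter groups $A_n$ and $B_n$ are strong Sperner.
   Context: $A_n$ is the symmetry group of the regular $n$-simplex (the convex hull of the standard basis of $\mathbb{R}^{n+1}$), isomorphic to the symmetric group $S_{n+1}$, with reflections corresponding to transpositions. $B_n$ is the hyperoctahedral group, the symmetry group of the $n$-cube $[-1,1]^n$, isomorphic to the group of signed permutations of $\{\pm1,\dots,\pm n\}$. For a finite Coxeter group $W$ with set of reflections $T$, the absolute length $l_T(w)$ is the word length of $w$ with respect to the generating set $T$, and the absolute order on $W$ is defined by $\pi \le \mu$ iff $l_T(\mu)=l_T(\pi)+l_T(\pi^{-1}\mu)$; it is a graded poset with rank function $l_T$. For a finite graded poset $P=\bigsqcup_{i=0}^r P_i$ (rank levels $P_i$), a $k$-family is a subset containing no chain of $k+1$ elements; $P$ is $k$-Sperner if the union of some $k$ largest rank levels is a $k$-family of maximum size among all $k$-families, and $P$ is strong Sperner if it is $k$-Sperner for all $k\in[1,r+1]$. *)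

theory Defs
  imports "HOL-Analysis.Analysis"
begin

section \<open>Strong Sperner property of finite graded posets\<close>

text \<open>A poset is a carrier \<open>P\<close> with a relation \<open>R \<subseteq> P \<times> P\<close>, where \<open>(x, y) \<in> R\<close> means \<open>x \<le> y\<close>;
  \<open>rk\<close> is its rank function.\<close>

definition poset_covers :: "('a \<times> 'a) set \<Rightarrow> 'a \<Rightarrow> 'a \<Rightarrow> bool" where
  "poset_covers R x y \<longleftrightarrow>
     (x, y) \<in> R \<and> x \<noteq> y \<and> \<not> (\<exists>z. (x, z) \<in> R \<and> (z, y) \<in> R \<and> z \<noteq> x \<and> z \<noteq> y)"

definition finite_graded_poset :: "'a set \<Rightarrow> ('a \<times> 'a) set \<Rightarrow> ('a \<Rightarrow> nat) \<Rightarrow> bool" where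
  "finite_graded_poset P R rk \<longleftrightarrow>
     finite P \<and> P \<noteq> {} \<and> partial_order_on P R \<and>
     (\<forall>x\<in>P. (\<forall>y. (y, x) \<in> R \<longrightarrow> y = x) \<longrightarrow> rk x = 0) \<and>
     (\<forall>x\<in>P. \<forall>y\<in>P. poset_covers R x y \<longrightarrow> rk y = rk x + 1)"

definition rank_level :: "'a set \<Rightarrow> ('a \<Rightarrow> nat) \<Rightarrow> nat \<Rightarrow> 'a set" where
  "rank_level P rk i = {x \<in> P. rk x = i}"

definition poset_rank :: "'a set \<Rightarrow> ('a \<Rightarrow> nat) \<Rightarrow> nat" where
  "poset_rank P rk = Max (rk ` P)"

definition k_family :: "'a set \<Rightarrow> ('a \<times> 'a) set \<Rightarrow> nat \<Rightarrow> 'a set \<Rightarrow> bool" where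
  "k_family P R k F \<longleftrightarrow> F \<subseteq> P \<and> \<not> (\<exists>C. C \<subseteq> F \<and> C \<in> Chains R \<and> card C = k + 1)"

text \<open>\<open>I\<close> selects \<open>k\<close> largest rank levels; it need not be unique when levels have equal size.\<close>

definition k_Sperner :: "'a set \<Rightarrow> ('a \<times> 'a) set \<Rightarrow> ('a \<Rightarrow> nat) \<Rightarrow> nat \<Rightarrow> bool" where
  "k_Sperner P R rk k \<longleftrightarrow>
     (\<exists>I \<subseteq> {0..poset_rank P rk}.
        card I = k \<and>
        (\<forall>i\<in>I. \<forall>j\<in>{0..poset_rank P rk} - I.
           card (rank_level P rk j) \<le> card (rank_level P rk i)) \<and>
        k_family P R k (\<Union>i\<in>I. rank_level P rk i) \<and>
        (\<forall>F. k_family P R k F \<longrightarrow> card F \<le> card (\<Union>i\<in>I. rank_level P rk i)))"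

definition strong_Sperner :: "'a set \<Rightarrow> ('a \<times> 'a) set \<Rightarrow> ('a \<Rightarrow> nat) \<Rightarrow> bool" where
  "strong_Sperner P R rk \<longleftrightarrow>
     finite_graded_poset P R rk \<and> (\<forall>k\<in>{1..poset_rank P rk + 1}. k_Sperner P R rk k)"


section \<open>Absolute order of a finite reflection group\<close>

text \<open>A reflection group \<open>W\<close> is a set of linear maps of a Euclidean space, with composition as
  multiplication.\<close>

definition hyperplane_reflection :: "'a::euclidean_space \<Rightarrow> 'a \<Rightarrow> 'a" where
  "hyperplane_reflection v x = x - (2 * (v \<bullet> x) / (v \<bullet> v)) *\<^sub>R v"

definition reflections :: "('a::euclidean_space \<Rightarrow> 'a) set \<Rightarrow> ('a \<Rightarrow> 'a) set" where
  "reflections W = {t \<in> W. \<exists>v. v \<noteq> 0 \<and> t = hyperplane_reflection v}"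

text \<open>The minimum below is meaningful when the reflections generate \<open>W\<close>.\<close>

definition absolute_length :: "('a::euclidean_space \<Rightarrow> 'a) set \<Rightarrow> ('a \<Rightarrow> 'a) \<Rightarrow> nat" where
  "absolute_length W w =
     (LEAST k. \<exists>ts. length ts = k \<and> set ts \<subseteq> reflections W \<and> foldr (\<circ>) ts id = w)"

definition absolute_order ::
    "('a::euclidean_space \<Rightarrow> 'a) set \<Rightarrow> (('a \<Rightarrow> 'a) \<times> ('a \<Rightarrow> 'a)) set" where
  "absolute_order W =
     {(p, m). p \<in> W \<and> m \<in> W \<and>
        absolute_length W m = absolute_length W p + absolute_length W (inv p \<circ> m)}"


section \<open>The Coxeter groups of types A and B\<close>

definition symmetry_group :: "'a::euclidean_space set \<Rightarrow> ('a \<Rightarrow> 'a) set" where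
  "symmetry_group S = {f. orthogonal_transformation f \<and> f ` S = S}"

text \<open>The regular \<open>n\<close>-simplex lies in \<open>\<real>\<^sup>n\<^sup>+\<^sup>1\<close>, so \<open>coxeter_A\<close> is the group of type \<open>A\<^sub>n\<close> when
  \<open>CARD('n) = n + 1\<close>: each isometry of the simplex permutes its vertices, the standard basis, and
  so extends to exactly one linear map of \<open>\<real>\<^sup>n\<^sup>+\<^sup>1\<close>, a permutation of coordinates.  The reflections
  are then the transpositions of two coordinates.\<close>

definition coxeter_A :: "(real ^ 'n \<Rightarrow> real ^ 'n) set" where
  "coxeter_A = symmetry_group (convex hull Basis)"

text \<open>Isometries of the cube fix its centre \<open>0\<close>, hence are linear; \<open>coxeter_B\<close> is the group of type
  \<open>B\<^sub>n\<close> when \<open>CARD('n) = n\<close>.\<close>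

definition coxeter_B :: "(real ^ 'n \<Rightarrow> real ^ 'n) set" where
  "coxeter_B = symmetry_group {x. \<forall>i. x $ i \<in> {-1..1}}"

end

theory Submission
  imports Defs
begin

text \<open>
  Both groups \<open>W\<close> have the property that whenever \<open>w \<in> W\<close> moves a basis vector \<open>i\<close>, the reflection
  exchanging \<open>i\<close> and \<open>w i\<close> lies in \<open>W\<close>.  Hence every element fixing all basis vectors outside
  \<open>S \<union> {i}\<close> is uniquely \<open>u \<circ> t\<close>, where \<open>u\<close> fixes those outside \<open>S\<close> and \<open>t\<close> is the identity or the
  reflection exchanging \<open>i\<close> with another vector of its orbit.  The absolute length is the
  codimension of the fixed space, and it grows by one exactly when \<open>t\<close> is not the identity.  So \<open>W\<close>
  contains, level by level, a product of claws (a bottom element below an antichain).  By induction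
  on the number of factors, with log-concavity of the level sizes, there is a normalized flow
  between any two consecutive levels.  The flows give the LYM inequality
  \<open>\<Sum>\<^sub>i |F \<inter> P\<^sub>i| / |P\<^sub>i| \<le> k\<close> for every \<open>k\<close>-family \<open>F\<close>, which bounds \<open>|F|\<close> by the sum of the \<open>k\<close>
  largest level sizes.
\<close>

section \<open>Normalized flows and \<open>k\<close>-families\<close>

text \<open>Divided by \<open>card A * card B\<close>, such an \<open>f\<close> is a coupling of the
  uniform distributions on \<open>A\<close> and \<open>B\<close> supported on \<open>R\<close>. Left
  undivided, the zero function serves when \<open>A\<close> or \<open>B\<close> is empty.\<close>

definition normalized_flow ::
    "('a \<times> 'a) set \<Rightarrow> 'a set \<Rightarrow> 'a set \<Rightarrow> ('a \<Rightarrow> 'a \<Rightarrow> real) \<Rightarrow> bool" where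
  "normalized_flow R A B f \<longleftrightarrow>
     (\<forall>x\<in>A. \<forall>y\<in>B. 0 \<le> f x y \<and> (f x y \<noteq> 0 \<longrightarrow> (x, y) \<in> R)) \<and>
     (\<forall>x\<in>A. (\<Sum>y\<in>B. f x y) = real (card B)) \<and>
     (\<forall>y\<in>B. (\<Sum>x\<in>A. f x y) = real (card A))"

text \<open>Average the pointwise inequality against \<open>f\<close>: both marginals are uniform,
  so each term becomes a plain average over \<open>A\<close> or \<open>B\<close>.\<close>

lemma normalized_flow_average_mono:
  fixes h g :: "'a \<Rightarrow> real"
  assumes flow: "normalized_flow R A B f"
    and fin: "finite A" "finite B" "A \<noteq> {}" "B \<noteq> {}"
    and mono: "\<And>x y. x \<in> A \<Longrightarrow> y \<in> B \<Longrightarrow> (x, y) \<in> R \<Longrightarrow> h x + g y \<le> h y"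
  shows "(\<Sum>x\<in>A. h x) / card A + (\<Sum>y\<in>B. g y) / card B \<le> (\<Sum>y\<in>B. h y) / card B"
proof -
  have rows: "(\<Sum>y\<in>B. f x y) = card B" if "x \<in> A" for x
    using flow that by (auto simp: normalized_flow_def)
  have cols: "(\<Sum>x\<in>A. f x y) = card A" if "y \<in> B" for y
    using flow that by (auto simp: normalized_flow_def)
  have col_sum: "(\<Sum>x\<in>A. \<Sum>y\<in>B. f x y * s y) = card A * (\<Sum>y\<in>B. s y)" for s :: "'a \<Rightarrow> real"
    by (subst sum.swap) (simp add: cols sum_distrib_left flip: sum_distrib_right)
  have "card B * (\<Sum>x\<in>A. h x) + card A * (\<Sum>y\<in>B. g y)
      = (\<Sum>x\<in>A. \<Sum>y\<in>B. f x y * h x) + (\<Sum>x\<in>A. \<Sum>y\<in>B. f x y * g y)"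
    by (simp add: col_sum) (simp add: rows sum_distrib_left flip: sum_distrib_right)
  also have "\<dots> = (\<Sum>x\<in>A. \<Sum>y\<in>B. f x y * (h x + g y))"
    by (simp add: sum.distrib distrib_left)
  also have "\<dots> \<le> (\<Sum>x\<in>A. \<Sum>y\<in>B. f x y * h y)"
  proof (intro sum_mono)
    fix x y assume xy: "x \<in> A" "y \<in> B"
    then have "0 \<le> f x y" "f x y \<noteq> 0 \<Longrightarrow> (x, y) \<in> R"
      using flow by (auto simp: normalized_flow_def)
    then show "f x y * (h x + g y) \<le> f x y * h y"
      by (cases "f x y = 0") (auto intro: mult_left_mono mono[OF xy])
  qed
  also have "\<dots> = card A * (\<Sum>y\<in>B. h y)"
    by (simp add: col_sum)
  finally have "card B * (\<Sum>x\<in>A. h x) + card A * (\<Sum>y\<in>B. g y) \<le> card A * (\<Sum>y\<in>B. h y)" .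
  then have "(card B * (\<Sum>x\<in>A. h x) + card A * (\<Sum>y\<in>B. g y)) / (card A * card B)
      \<le> card A * (\<Sum>y\<in>B. h y) / (card A * card B)"
    by (rule divide_right_mono) simp
  then show ?thesis
    using fin by (simp add: add_divide_distrib)
qed

text \<open>Needed because the claw product consists of pairs \<open>(u, b)\<close>, while the
  levels of the group consist of maps.\<close>

lemma normalized_flow_transport:
  assumes flow: "normalized_flow Q X Y F"
    and bij: "bij_betw g X A" "bij_betw g Y B"
    and rel: "\<And>x y. x \<in> X \<Longrightarrow> y \<in> Y \<Longrightarrow> (x, y) \<in> Q \<Longrightarrow> (g x, g y) \<in> R"
  shows "\<exists>f. normalized_flow R A B f"
proof -
  define f where "f a b = F (inv_into X g a) (inv_into Y g b)" for a b
  have bij': "bij_betw (inv_into X g) A X" "bij_betw (inv_into Y g) B Y"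
    using bij by (auto intro: bij_betw_inv_into)
  have mem: "inv_into X g a \<in> X" "g (inv_into X g a) = a" if "a \<in> A" for a
    using bij(1) bij'(1) that by (auto simp: bij_betw_def f_inv_into_f)
  have mem': "inv_into Y g b \<in> Y" "g (inv_into Y g b) = b" if "b \<in> B" for b
    using bij(2) bij'(2) that by (auto simp: bij_betw_def f_inv_into_f)
  have "(\<Sum>b\<in>B. f a b) = real (card B)" if "a \<in> A" for a
  proof -
    have "(\<Sum>b\<in>B. f a b) = (\<Sum>y\<in>Y. F (inv_into X g a) y)"
      unfolding f_def by (rule sum.reindex_bij_betw[OF bij'(2)])
    also have "\<dots> = card Y"
      using flow mem(1)[OF that] by (auto simp: normalized_flow_def)
    finally show ?thesis
      using bij_betw_same_card[OF bij(2)] by simp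
  qed
  moreover have "(\<Sum>a\<in>A. f a b) = real (card A)" if "b \<in> B" for b
  proof -
    have "(\<Sum>a\<in>A. f a b) = (\<Sum>x\<in>X. F x (inv_into Y g b))"
      unfolding f_def by (rule sum.reindex_bij_betw[OF bij'(1)])
    also have "\<dots> = card X"
      using flow mem'(1)[OF that] by (auto simp: normalized_flow_def)
    finally show ?thesis
      using bij_betw_same_card[OF bij(1)] by simp
  qed
  moreover have "0 \<le> f a b \<and> (f a b \<noteq> 0 \<longrightarrow> (a, b) \<in> R)" if "a \<in> A" "b \<in> B" for a b
    using flow mem[OF that(1)] mem'[OF that(2)] rel[of "inv_into X g a" "inv_into Y g b"]
    unfolding normalized_flow_def f_def by auto
  ultimately show ?thesis
    unfolding normalized_flow_def by blast
qed

text \<open>Adjoining a claw with bottom \<open>i\<close> and top elements \<open>C\<close> as a further direct factor.  The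
  coefficients \<open>\<alpha>\<close>, \<open>\<beta>\<close> and \<open>\<gamma>\<close> are forced by the required row and column sums, and
  log-concavity is exactly what makes \<open>\<beta>\<close> nonnegative.\<close>

lemma normalized_flow_claw_product:
  fixes A0 A1 A2 :: "'a set" and C :: "'c set"
  assumes fin: "finite A0" "finite A1" "finite A2" "finite C" and i: "i \<notin> C"
    and flow: "normalized_flow R A0 A1 f" "normalized_flow R A1 A2 f'"
    and log_concave: "card A0 * card A2 \<le> card A1 ^ 2"
    and empty: "A1 = {} \<Longrightarrow> A2 = {}"
    and rel: "\<And>u v. u \<in> A1 \<Longrightarrow> v \<in> A2 \<Longrightarrow> (u, v) \<in> R \<Longrightarrow> ((u, i), (v, i)) \<in> Q"
      "\<And>u b. u \<in> A1 \<Longrightarrow> b \<in> C \<Longrightarrow> ((u, i), (u, b)) \<in> Q"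
      "\<And>u v b. u \<in> A0 \<Longrightarrow> v \<in> A1 \<Longrightarrow> b \<in> C \<Longrightarrow> (u, v) \<in> R \<Longrightarrow> ((u, b), (v, b)) \<in> Q"
  shows "\<exists>F. normalized_flow Q (A1 \<times> {i} \<union> A0 \<times> C) (A2 \<times> {i} \<union> A1 \<times> C) F"
proof (cases "A1 = {}")
  case True
  \<comment> \<open>With \<open>A1\<close> empty so is \<open>A2\<close>, hence the whole upper
    level, and every required row sum is zero.\<close>
  then have "normalized_flow Q (A1 \<times> {i} \<union> A0 \<times> C) (A2 \<times> {i} \<union> A1 \<times> C) (\<lambda>_ _. 0)"
    using empty by (simp add: normalized_flow_def)
  then show ?thesis by blast
next
  case False
  define a0 a1 a2 e where "a0 = real (card A0)" and "a1 = real (card A1)"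
    and "a2 = real (card A2)" and "e = real (card C)"
  have a1: "a1 > 0"
    using False fin by (auto simp: a1_def card_gt_0_iff)
  define \<alpha> \<beta> \<gamma> where "\<alpha> = (a1 + e * a0) / a1" and "\<beta> = a1 - a0 * a2 / a1"
    and "\<gamma> = (a2 + e * a1) / a1"
  have nonneg: "0 \<le> \<alpha>" "0 \<le> \<gamma>"
    using a1 by (auto simp: \<alpha>_def \<gamma>_def a0_def a2_def e_def)
  have "real (card A0 * card A2) \<le> real (card A1 ^ 2)"
    using log_concave by (simp only: of_nat_le_iff)
  then have "0 \<le> \<beta>"
    using a1 by (simp add: \<beta>_def a0_def a1_def a2_def field_simps power2_eq_square)
  \<comment> \<open>Three kinds of edges: a step in the first factor above the bottom
    \<open>i\<close> (weight \<alpha>), a step from \<open>i\<close> to a top element (\<beta>), a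
    step in the first factor above a fixed top element (\<gamma>). Columns over \<open>i\<close>
    meet only the first kind and rows over \<open>C\<close> only the third, which fixes \<alpha> and
    \<gamma>; \<beta> makes up the remainder.\<close>
  define F where "F x y =
      (if snd x = i
       then if snd y = i then \<alpha> * f' (fst x) (fst y) else if fst x = fst y then \<beta> else 0
       else if snd y = snd x then \<gamma> * f (fst x) (fst y) else 0)" for x y :: "'a \<times> 'c"
  let ?X = "A1 \<times> {i} \<union> A0 \<times> C" and ?Y = "A2 \<times> {i} \<union> A1 \<times> C"
  have disj: "(U \<times> {i}) \<inter> (V \<times> C) = {}" for U V :: "'a set"
    using i by auto
  have card_union: "real (card (U \<times> {i} \<union> V \<times> C)) = card U + e * card V"
    if "finite U" "finite V" for U V :: "'a set"
    using that fin disj by (subst card_Un_disjoint) (auto simp: card_cartesian_product e_def)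
  have sum_union: "(\<Sum>x\<in>U \<times> {i} \<union> V \<times> C. s x) = (\<Sum>u\<in>U. s (u, i)) + (\<Sum>u\<in>V. \<Sum>b\<in>C. s (u, b))"
    if "finite U" "finite V" for U V :: "'a set" and s :: "'a \<times> 'c \<Rightarrow> real"
    using that fin disj
    by (subst sum.union_disjoint) (auto simp: sum.cartesian_product')
  have neq: "b \<noteq> i" "i \<noteq> b" if "b \<in> C" for b
    using that i by auto
  have flow_sums:
    "\<And>u. u \<in> A0 \<Longrightarrow> (\<Sum>v\<in>A1. f u v) = a1" "\<And>v. v \<in> A1 \<Longrightarrow> (\<Sum>u\<in>A0. f u v) = a0"
    "\<And>u. u \<in> A1 \<Longrightarrow> (\<Sum>v\<in>A2. f' u v) = a2" "\<And>v. v \<in> A2 \<Longrightarrow> (\<Sum>u\<in>A1. f' u v) = a1"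
    using flow by (auto simp: normalized_flow_def a0_def a1_def a2_def)
  have "(\<Sum>y\<in>?Y. F x y) = card ?Y" if "x \<in> ?X" for x
  proof (cases "snd x = i")
    case True
    then have x: "x = (fst x, i)" "fst x \<in> A1"
      using that i by (auto simp: prod_eq_iff)
    have "(\<Sum>y\<in>?Y. F x y) = \<alpha> * (\<Sum>v\<in>A2. f' (fst x) v) + (\<Sum>u\<in>A1. e * (if fst x = u then \<beta> else 0))"
      using True neq fin
      by (simp add: sum_union F_def sum_distrib_left[of \<alpha>] e_def cong: sum.cong)
    also have "\<dots> = \<alpha> * a2 + e * \<beta>"
      using x fin by (simp add: flow_sums flip: sum_distrib_left)
    also have "\<dots> = a2 + e * a1"
      using a1 by (simp add: \<alpha>_def \<beta>_def field_simps)
    finally show ?thesis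
      using fin by (simp add: card_union a1_def a2_def)
  next
    case False
    then have x: "fst x \<in> A0" "snd x \<in> C"
      using that by auto
    have "(\<Sum>y\<in>?Y. F x y) = (\<Sum>v\<in>A1. \<Sum>b\<in>C. if b = snd x then \<gamma> * f (fst x) v else 0)"
      using False fin by (simp add: sum_union F_def cong: if_cong)
    also have "\<dots> = \<gamma> * a1"
      using x fin by (simp add: flow_sums flip: sum_distrib_left)
    also have "\<dots> = a2 + e * a1"
      using a1 by (simp add: \<gamma>_def)
    finally show ?thesis
      using fin by (simp add: card_union a1_def a2_def)
  qed
  moreover have "(\<Sum>x\<in>?X. F x y) = card ?X" if "y \<in> ?Y" for y
  proof (cases "snd y = i")
    case True
    then have y: "fst y \<in> A2"
      using that i by auto
    have "(\<Sum>x\<in>?X. F x y) = (\<Sum>u\<in>A1. \<alpha> * f' u (fst y))"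
      using True neq fin by (simp add: sum_union F_def cong: sum.cong)
    also have "\<dots> = \<alpha> * a1"
      using y by (simp add: flow_sums flip: sum_distrib_left)
    also have "\<dots> = a1 + e * a0"
      using a1 by (simp add: \<alpha>_def)
    finally show ?thesis
      using fin by (simp add: card_union a1_def a0_def)
  next
    case False
    then have y: "fst y \<in> A1" "snd y \<in> C"
      using that by auto
    have "(\<Sum>x\<in>?X. F x y) = (\<Sum>u\<in>A1. if u = fst y then \<beta> else 0)
        + (\<Sum>u\<in>A0. \<Sum>b\<in>C. if b = snd y then \<gamma> * f u (fst y) else 0)"
      using False neq fin by (auto simp: sum_union F_def intro!: sum.cong)
    also have "\<dots> = \<beta> + \<gamma> * a0"
      using y fin by (simp add: flow_sums flip: sum_distrib_left)
    also have "\<dots> = a1 + e * a0"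
      using a1 by (simp add: \<beta>_def \<gamma>_def field_simps)
    finally show ?thesis
      using fin by (simp add: card_union a1_def a0_def)
  qed
  moreover have "0 \<le> F x y \<and> (F x y \<noteq> 0 \<longrightarrow> (x, y) \<in> Q)" if "x \<in> ?X" "y \<in> ?Y" for x y
    using that flow nonneg \<open>0 \<le> \<beta>\<close> rel neq
    unfolding F_def normalized_flow_def by (fastforce split: if_splits)
  ultimately have "normalized_flow Q ?X ?Y F"
    unfolding normalized_flow_def by blast
  then show ?thesis by blast
qed

section \<open>Optimizing over the largest levels\<close>

text \<open>Greedy choice: \<open>I\<close> dominates everything outside it, and adding a maximum of
  the rest preserves this.\<close>

lemma ex_top_subset:
  fixes f :: "'a \<Rightarrow> 'b::linorder"
  assumes "finite A" "k \<le> card A"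
  shows "\<exists>I\<subseteq>A. card I = k \<and> (\<forall>i\<in>I. \<forall>j\<in>A - I. f j \<le> f i)"
  using assms(2)
proof (induction k)
  case 0
  then show ?case by (intro exI[of _ "{}"]) auto
next
  case (Suc k)
  then obtain I where I: "I \<subseteq> A" "card I = k" "\<forall>i\<in>I. \<forall>j\<in>A - I. f j \<le> f i"
    by auto
  have "finite I" "A - I \<noteq> {}"
    using I Suc.prems assms(1) by (auto intro: finite_subset)
  define m where "m = Max (f ` (A - I))"
  have "m \<in> f ` (A - I)"
    unfolding m_def using assms(1) \<open>A - I \<noteq> {}\<close> by (intro Max_in) auto
  then obtain a where a: "a \<in> A - I" "f a = m"
    by auto
  have "f j \<le> f a" if "j \<in> A - I" for j
    using that assms(1) by (auto simp: a m_def)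
  with I a \<open>finite I\<close> show ?case
    by (intro exI[of _ "insert a I"]) auto
qed

text \<open>A fractional knapsack bound: the ratios \<open>f i / N i\<close> lie in [0,1] and sum to
  at most \<open>card I\<close>, so the best use of them is to fill the largest \<open>N i\<close>.
  The threshold \<open>m\<close>, the smallest \<open>N i\<close> on \<open>I\<close>, separates the
  two sides of the exchange.\<close>

lemma sum_le_sum_top:
  fixes f N :: "'a \<Rightarrow> nat"
  assumes "finite A" "I \<subseteq> A" "I \<noteq> {}"
    and top: "\<And>i j. i \<in> I \<Longrightarrow> j \<in> A - I \<Longrightarrow> N j \<le> N i"
    and pos: "\<And>i. i \<in> A \<Longrightarrow> 0 < N i" and le: "\<And>i. i \<in> A \<Longrightarrow> f i \<le> N i"
    and ratio: "(\<Sum>i\<in>A. f i / N i) \<le> card I"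
  shows "(\<Sum>i\<in>A. f i) \<le> (\<Sum>i\<in>I. N i)"
proof -
  have fin: "finite I" "finite (A - I)"
    using assms by (auto intro: finite_subset)
  define m where "m = Min (N ` I)"
  have "m \<in> N ` I"
    unfolding m_def using fin assms(3) by (intro Min_in) auto
  then have m_top: "N j \<le> m" if "j \<in> A - I" for j
    using top that by auto
  have m_low: "m \<le> N i" if "i \<in> I" for i
    unfolding m_def using fin that by auto
  have split: "(\<Sum>i\<in>A. s i) = (\<Sum>i\<in>I. s i) + (\<Sum>i\<in>A - I. s i)" for s :: "'a \<Rightarrow> real"
    using sum.subset_diff[OF assms(2,1), of s] by simp
  have "(\<Sum>i\<in>A - I. real (f i)) \<le> (\<Sum>i\<in>A - I. real m * (f i / N i))"
  proof (rule sum_mono)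
    fix i assume i: "i \<in> A - I"
    have "real (f i) = N i * (f i / N i)"
      using pos[of i] i by auto
    also have "\<dots> \<le> m * (f i / N i)"
      using m_top[OF i] by (intro mult_right_mono) auto
    finally show "real (f i) \<le> m * (f i / N i)" .
  qed
  also have "\<dots> = m * (\<Sum>i\<in>A - I. f i / N i)"
    by (simp add: sum_distrib_left)
  \<comment> \<open>By \<open>ratio\<close>, the mass outside \<open>I\<close> is at most the slack
    left inside \<open>I\<close>.\<close>
  also have "\<dots> \<le> m * (\<Sum>i\<in>I. 1 - f i / N i)"
    using ratio by (intro mult_left_mono) (simp_all add: split sum_subtractf)
  also have "\<dots> = (\<Sum>i\<in>I. m * (1 - f i / N i))"
    by (simp add: sum_distrib_left)
  also have "\<dots> \<le> (\<Sum>i\<in>I. real (N i) - f i)"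
  proof (rule sum_mono)
    fix i assume i: "i \<in> I"
    then have "i \<in> A"
      using assms by auto
    then have "m * (1 - f i / N i) \<le> N i * (1 - f i / N i)"
      using m_low[OF i] le[of i] pos[of i] by (intro mult_right_mono) (auto simp: field_simps)
    also have "\<dots> = real (N i) - f i"
      using pos[OF \<open>i \<in> A\<close>] by (simp add: field_simps)
    finally show "m * (1 - f i / N i) \<le> real (N i) - f i" .
  qed
  finally have "(\<Sum>i\<in>A. real (f i)) \<le> (\<Sum>i\<in>I. real (N i))"
    using split[of f] by (simp add: sum_subtractf)
  then show ?thesis
    by (simp flip: of_nat_sum)
qed

section \<open>LYM inequality and Sperner property from flows\<close>

context
  fixes P :: "'a set" and R :: "('a \<times> 'a) set" and rk :: "'a \<Rightarrow> nat"
  assumes fin: "finite P" and po: "partial_order_on P R"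
    and rk_mono: "\<And>x y. (x, y) \<in> R \<Longrightarrow> x \<noteq> y \<Longrightarrow> rk x < rk y"
begin

text \<open>\<open>k_family\<close> forbids chains of exactly \<open>k + 1\<close> elements; a
  longer chain would contain one of these.\<close>

lemma k_family_chain_card_le:
  assumes "k_family P R k F" "C \<subseteq> F" "C \<in> Chains R"
  shows "card C \<le> k"
proof (rule ccontr)
  assume "\<not> card C \<le> k"
  then obtain D where "D \<subseteq> C" "card D = k + 1"
    using obtain_subset_with_card_n[of "k + 1" C] by auto
  moreover have "D \<in> Chains R"
    using \<open>D \<subseteq> C\<close> assms(3) by (auto simp: Chains_def)
  ultimately show False
    using assms by (auto simp: k_family_def)
qed

text \<open>The rank is injective on a chain, so a chain meets each level at most once.\<close>

lemma k_family_rank_levels: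
  assumes "finite I"
  shows "k_family P R (card I) (\<Union>i\<in>I. rank_level P rk i)"
  unfolding k_family_def
proof (intro conjI notI)
  assume "\<exists>C\<subseteq>\<Union>i\<in>I. rank_level P rk i. C \<in> Chains R \<and> card C = card I + 1"
  then obtain C where C: "C \<subseteq> (\<Union>i\<in>I. rank_level P rk i)" "C \<in> Chains R" "card C = card I + 1"
    by blast
  have "inj_on rk C"
  proof (rule inj_onI)
    fix x y assume "x \<in> C" "y \<in> C" "rk x = rk y"
    then show "x = y"
      using C(2) rk_mono[of x y] rk_mono[of y x] by (auto simp: Chains_def)
  qed
  moreover have "rk ` C \<subseteq> I"
    using C(1) by (auto simp: rank_level_def)
  ultimately have "card C \<le> card I"
    using assms by (metis card_image card_mono)
  with C(3) show False by simp
qed (auto simp: rank_level_def)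

text \<open>The LYM inequality: the average over a rank level of the height below a point
  of the longest chain in \<open>F\<close> grows from level to level at least by the density of \<open>F\<close>.\<close>

lemma k_family_density_sum_le:
  fixes r :: nat
  assumes nonempty: "\<And>i. i \<le> r \<Longrightarrow> rank_level P rk i \<noteq> {}"
    and flow: "\<And>i. i < r \<Longrightarrow> \<exists>f. normalized_flow R (rank_level P rk i) (rank_level P rk (Suc i)) f"
    and F: "k_family P R k F"
  shows "(\<Sum>i\<le>r. card (F \<inter> rank_level P rk i) / card (rank_level P rk i)) \<le> k"
proof -
  let ?L = "rank_level P rk"
  have finL: "finite (?L i)" for i
    using fin by (simp add: rank_level_def)
  have FP: "F \<subseteq> P" "finite F"
    using F fin by (auto simp: k_family_def intro: finite_subset)
  have refl: "(x, x) \<in> R" if "x \<in> P" for x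
    using po that by (auto simp: partial_order_on_def preorder_on_def refl_on_def)
  have trans: "(x, z) \<in> R" if "(x, y) \<in> R" "(y, z) \<in> R" for x y z
    using po that by (auto simp: partial_order_on_def preorder_on_def dest: transD)
  \<comment> \<open>The point \<open>x\<close> need not lie in \<open>F\<close>, so the height
    \<open>h\<close> is defined on whole levels and can be averaged over them.\<close>
  define below where "below x = {C. C \<subseteq> F \<and> C \<in> Chains R \<and> (\<forall>c\<in>C. (c, x) \<in> R)}" for x
  define h where "h x = Max (card ` below x)" for x
  have fin_below: "finite (below x)" for x
    using FP by (auto simp: below_def intro: finite_subset[of _ "Pow F"])
  have h_ge: "card C \<le> h x" if "C \<in> below x" for C x
    unfolding h_def using fin_below that by (intro Max_ge) auto
  have h_attained: "\<exists>C\<in>below x. h x = card C" for x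
  proof -
    have "{} \<in> below x"
      by (auto simp: below_def Chains_def)
    then have "h x \<in> card ` below x"
      unfolding h_def using fin_below by (intro Max_in) auto
    then show ?thesis by auto
  qed
  have h_le: "h x \<le> k" for x
    using h_attained[of x] k_family_chain_card_le[OF F] by (auto simp: below_def)
  have h_base: "indicator F x \<le> h x" if "x \<in> P" for x
  proof (cases "x \<in> F")
    case True
    then have "{x} \<in> below x"
      using refl[OF that] by (auto simp: below_def Chains_def)
    then show ?thesis
      using h_ge[of "{x}" x] True by simp
  qed simp
  have h_step: "h x + indicator F y \<le> h y" if xy: "(x, y) \<in> R" "x \<noteq> y" and "y \<in> P" for x y
  proof -
    obtain C where C: "C \<in> below x" "h x = card C"
      using h_attained by blast
    have Cy: "C \<in> below y"
      using C(1) trans[OF _ xy(1)] by (auto simp: below_def)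
    show ?thesis
    proof (cases "y \<in> F")
      case True
      have "insert y C \<in> below y"
        using Cy refl[OF \<open>y \<in> P\<close>] True by (auto simp: below_def Chains_def)
      \<comment> \<open>Otherwise \<open>y\<close> would lie below \<open>x\<close> as well as above
        it, against strict monotonicity of the rank.\<close>
      moreover have "y \<notin> C"
        using C(1) rk_mono[of x y] rk_mono[of y x] xy by (auto simp: below_def)
      moreover have "finite C"
        using C(1) FP by (auto simp: below_def intro: finite_subset)
      ultimately show ?thesis
        using h_ge[of "insert y C" y] C(2) True by simp
    next
      case False
      then show ?thesis
        using h_ge[OF Cy] C(2) by simp
    qed
  qed
  have ind: "(\<Sum>x\<in>?L i. indicator F x) = real (card (F \<inter> ?L i))" for i
    using finL by (simp add: indicator_def sum.If_cases Int_commute)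
  have "(\<Sum>i\<le>m. card (F \<inter> ?L i) / card (?L i)) \<le> (\<Sum>x\<in>?L m. real (h x)) / card (?L m)"
    if "m \<le> r" for m
    using that
  proof (induction m)
    case 0
    have "real (card (F \<inter> ?L 0)) \<le> (\<Sum>x\<in>?L 0. real (h x))"
      unfolding ind[symmetric]
    proof (rule sum_mono)
      fix x assume "x \<in> ?L 0"
      then show "indicator F x \<le> real (h x)"
        using h_base[of x] by (auto simp: rank_level_def indicator_def split: if_splits)
    qed
    then show ?case
      by (simp add: divide_right_mono)
  next
    case (Suc m)
    then obtain f where f: "normalized_flow R (?L m) (?L (Suc m)) f"
      using flow[of m] by auto
    have "(\<Sum>x\<in>?L m. real (h x)) / card (?L m) + (\<Sum>y\<in>?L (Suc m). indicator F y) / card (?L (Suc m))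
        \<le> (\<Sum>y\<in>?L (Suc m). real (h y)) / card (?L (Suc m))"
    proof (rule normalized_flow_average_mono[OF f finL finL])
      fix x y assume xy: "x \<in> ?L m" "y \<in> ?L (Suc m)" "(x, y) \<in> R"
      then have "x \<noteq> y" "y \<in> P"
        by (auto simp: rank_level_def)
      from h_step[OF xy(3) this] show "real (h x) + indicator F y \<le> real (h y)"
        by (auto simp: indicator_def split: if_splits)
    qed (use Suc.prems nonempty in auto)
    with Suc show ?case
      by (simp add: ind)
  qed
  from this[of r] have "(\<Sum>i\<le>r. card (F \<inter> ?L i) / card (?L i)) \<le> (\<Sum>x\<in>?L r. real (h x)) / card (?L r)"
    by simp
  also have "\<dots> \<le> k"
  proof -
    have "(\<Sum>x\<in>?L r. real (h x)) \<le> k * card (?L r)"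
      using sum_bounded_above[of "?L r" "\<lambda>x. real (h x)" k] h_le by (simp add: mult.commute)
    moreover have "card (?L r) > 0"
      using nonempty[of r] finL by (simp add: card_gt_0_iff)
    ultimately show ?thesis
      by (simp add: field_simps)
  qed
  finally show ?thesis .
qed

text \<open>By the LYM inequality the densities of a \<open>k\<close>-family in the levels sum to at
  most \<open>k\<close>; weighted by level sizes, such a sum is largest when \<open>k\<close>
  largest levels are filled.\<close>

lemma k_Sperner_if_normalized_flow:
  assumes nonempty: "\<And>i. i \<le> poset_rank P rk \<Longrightarrow> rank_level P rk i \<noteq> {}"
    and flow: "\<And>i. i < poset_rank P rk \<Longrightarrow>
      \<exists>f. normalized_flow R (rank_level P rk i) (rank_level P rk (Suc i)) f"
    and k: "1 \<le> k" "k \<le> poset_rank P rk + 1"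
  shows "k_Sperner P R rk k"
proof -
  let ?L = "rank_level P rk" and ?r = "poset_rank P rk"
  have finL: "finite (?L i)" for i
    using fin by (simp add: rank_level_def)
  obtain I where I: "I \<subseteq> {0..?r}" "card I = k"
      "\<forall>i\<in>I. \<forall>j\<in>{0..?r} - I. card (?L j) \<le> card (?L i)"
    using ex_top_subset[of "{0..?r}" k "\<lambda>i. card (?L i)"] k by auto
  have "finite I" "I \<noteq> {}"
    using I k by (auto intro: finite_subset)
  have union: "card (\<Union>i\<in>I. ?L i) = (\<Sum>i\<in>I. card (?L i))"
    using \<open>finite I\<close> finL by (intro card_UN_disjoint) (auto simp: rank_level_def)
  have "card F \<le> (\<Sum>i\<in>I. card (?L i))" if F: "k_family P R k F" for F
  proof -
    have "F = (\<Union>i\<le>?r. F \<inter> ?L i)"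
      using F fin by (auto simp: k_family_def rank_level_def poset_rank_def)
    then have "card F = card (\<Union>i\<le>?r. F \<inter> ?L i)"
      by simp
    also have "\<dots> = (\<Sum>i\<le>?r. card (F \<inter> ?L i))"
      using finL by (intro card_UN_disjoint) (auto simp: rank_level_def)
    also have "\<dots> \<le> (\<Sum>i\<in>I. card (?L i))"
    proof (rule sum_le_sum_top)
      show "(\<Sum>i\<le>?r. card (F \<inter> ?L i) / card (?L i)) \<le> card I"
        using k_family_density_sum_le[OF nonempty flow F] I by simp
      show "0 < card (?L i)" if "i \<in> {..?r}" for i
        using nonempty[of i] finL that by (simp add: card_gt_0_iff)
      show "card (F \<inter> ?L i) \<le> card (?L i)" for i
        using finL by (intro card_mono) auto
    qed (use I \<open>I \<noteq> {}\<close> in \<open>auto simp: atMost_atLeast0\<close>)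
    finally show ?thesis .
  qed
  moreover have "k_family P R k (\<Union>i\<in>I. ?L i)"
    using k_family_rank_levels[OF \<open>finite I\<close>] I by simp
  ultimately show ?thesis
    unfolding k_Sperner_def using I union by (intro exI[of _ I]) auto
qed

end


section \<open>Codimension of the fixed space\<close>

definition fix_space :: "('a::euclidean_space \<Rightarrow> 'a) \<Rightarrow> 'a set" where
  "fix_space w = {x. w x = x}"

text \<open>Stands in for the absolute length, with which it agrees on the groups below
  (\<open>absolute_length_eq_fix_codim\<close>), and is open to linear algebra.\<close>

definition fix_codim :: "('a::euclidean_space \<Rightarrow> 'a) \<Rightarrow> nat" where
  "fix_codim w = DIM('a) - dim (fix_space w)"

lemma subspace_fix_space: "linear w \<Longrightarrow> subspace (fix_space w)"
  by (auto simp: fix_space_def subspace_def linear_0 linear_add linear_scale)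

lemma fix_codim_add_dim: "fix_codim w + dim (fix_space w) = DIM('a)" for w :: "'a::euclidean_space \<Rightarrow> 'a"
  using dim_subset_UNIV[of "fix_space w"] by (simp add: fix_codim_def)

lemma dim_Int_ge:
  fixes S T :: "'a::euclidean_space set"
  assumes "subspace S" "subspace T"
  shows "dim S + dim T \<le> dim (S \<inter> T) + DIM('a)"
  using dim_sums_Int[OF assms] dim_subset_UNIV[of "{x + y |x y. x \<in> S \<and> y \<in> T}"] by simp

text \<open>A point fixed by both factors is fixed by the product, and codimension is subadditive
  under intersection. This is the triangle inequality for the absolute length.\<close>

lemma fix_codim_comp_le:
  assumes "linear u" "linear w"
  shows "fix_codim (u \<circ> w) \<le> fix_codim u + fix_codim w"
proof -
  have "dim (fix_space u \<inter> fix_space w) \<le> dim (fix_space (u \<circ> w))"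
    by (rule dim_subset) (auto simp: fix_space_def)
  then show ?thesis
    using dim_Int_ge[OF subspace_fix_space[OF assms(1)] subspace_fix_space[OF assms(2)]]
      fix_codim_add_dim[of u] fix_codim_add_dim[of w] fix_codim_add_dim[of "u \<circ> w"]
    by linarith
qed

lemma fix_codim_id [simp]: "fix_codim id = 0" "fix_codim (\<lambda>x. x) = 0"
  by (simp_all add: fix_codim_def fix_space_def)

lemma fix_codim_eq_0_iff:
  assumes "linear w"
  shows "fix_codim w = 0 \<longleftrightarrow> w = id"
proof
  assume "fix_codim w = 0"
  then have "dim (fix_space w) = dim (UNIV :: 'a set)"
    using fix_codim_add_dim[of w] by simp
  then have "fix_space w = UNIV"
    using subspace_dim_equal[OF subspace_fix_space[OF assms] subspace_UNIV] by simp
  then have "x \<in> fix_space w" for x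
    by simp
  then show "w = id"
    unfolding fix_space_def mem_Collect_eq by (simp add: fun_eq_iff)
qed simp

text \<open>The bijection \<open>g\<close> carries the fixed space of the conjugate onto that of
  \<open>w\<close>.\<close>

lemma fix_codim_conj:
  fixes w g :: "'a::euclidean_space \<Rightarrow> 'a"
  assumes "linear w" "linear g" "bij g"
  shows "fix_codim (inv g \<circ> w \<circ> g) = fix_codim w"
proof -
  have "g ` fix_space (inv g \<circ> w \<circ> g) = fix_space w"
  proof (intro subset_antisym subsetI)
    fix y assume "y \<in> fix_space w"
    then have "g (inv g y) = y" "inv g y \<in> fix_space (inv g \<circ> w \<circ> g)"
      using assms(3) by (auto simp: fix_space_def bij_is_surj surj_f_inv_f)
    then show "y \<in> g ` fix_space (inv g \<circ> w \<circ> g)"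
      by (metis imageI)
  next
    fix y assume "y \<in> g ` fix_space (inv g \<circ> w \<circ> g)"
    then obtain x where "inv g (w (g x)) = x" "y = g x"
      by (auto simp: fix_space_def)
    then show "y \<in> fix_space w"
      using assms(3) by (metis (mono_tags) bij_is_surj fix_space_def mem_Collect_eq surj_f_inv_f)
  qed
  moreover have "dim (g ` fix_space (inv g \<circ> w \<circ> g)) = dim (fix_space (inv g \<circ> w \<circ> g))"
    using assms by (intro dim_image_eq) (auto intro: inj_on_subset[OF bij_is_inj])
  ultimately show ?thesis
    by (simp add: fix_codim_def)
qed

section \<open>Hyperplane reflections\<close>

lemma hyperplane_reflection_fixes: "v \<bullet> x = 0 \<Longrightarrow> hyperplane_reflection v x = x"
  by (simp add: hyperplane_reflection_def)

lemma linear_hyperplane_reflection: "linear (hyperplane_reflection v)"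
  by (rule linearI) (auto simp: hyperplane_reflection_def algebra_simps add_divide_distrib)

lemma fix_codim_hyperplane_reflection_le:
  fixes v :: "'a::euclidean_space"
  assumes "v \<noteq> 0"
  shows "fix_codim (hyperplane_reflection v) \<le> 1"
proof -
  have "DIM('a) - 1 = dim {x. v \<bullet> x = 0}"
    using dim_hyperplane[OF assms] by simp
  also have "\<dots> \<le> dim (fix_space (hyperplane_reflection v))"
    by (rule dim_subset) (auto simp: fix_space_def hyperplane_reflection_fixes)
  finally show ?thesis
    by (simp add: fix_codim_def)
qed

lemma hyperplane_reflection_0 [simp]: "hyperplane_reflection 0 = id"
  by (auto simp: hyperplane_reflection_def)

text \<open>Equal norms make \<open>2 * ((x - y) \<bullet> x)\<close> equal to
  \<open>(x - y) \<bullet> (x - y)\<close>, so the root is subtracted exactly once.\<close>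

lemma hyperplane_reflection_swap:
  assumes "norm x = norm y"
  shows "hyperplane_reflection (x - y) x = y"
proof (cases "x = y")
  case False
  have "x \<bullet> x = y \<bullet> y"
    using assms by (simp add: norm_eq)
  then have "2 * ((x - y) \<bullet> x) = (x - y) \<bullet> (x - y)"
    by (simp add: algebra_simps inner_commute)
  then show ?thesis
    using False by (simp add: hyperplane_reflection_def)
qed (simp add: hyperplane_reflection_def)

lemma hyperplane_reflection_involution: "hyperplane_reflection v \<circ> hyperplane_reflection v = id"
proof (cases "v = 0")
  case False
  then show ?thesis
    by (auto simp: hyperplane_reflection_def inner_diff_right fun_eq_iff scaleR_diff_left[symmetric])
qed (auto simp: hyperplane_reflection_def)

lemma orthogonal_transformation_hyperplane_reflection:
  "orthogonal_transformation (hyperplane_reflection v)"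
  unfolding orthogonal_transformation_def
proof (intro conjI allI linear_hyperplane_reflection)
  fix x y
  show "hyperplane_reflection v x \<bullet> hyperplane_reflection v y = x \<bullet> y"
    by (cases "v = 0")
      (auto simp: hyperplane_reflection_def inner_diff_left inner_diff_right inner_commute)
qed

text \<open>One more reflection whose root has a nonzero coordinate in a direction fixed by \<open>u\<close>
  raises the codimension: modulo that coordinate, a fixed point of the product is fixed
  by both factors.\<close>

lemma fix_codim_comp_reflection:
  fixes u :: "'a::euclidean_space \<Rightarrow> 'a"
  assumes u: "orthogonal_transformation u" and e: "u e = e" and v: "v \<bullet> e \<noteq> 0"
  shows "fix_codim (u \<circ> hyperplane_reflection v) = fix_codim u + 1"
proof (rule antisym)
  let ?t = "hyperplane_reflection v"
  have lin: "linear u"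
    using u by (rule orthogonal_transformation_linear)
  have "v \<noteq> 0"
    using v by auto
  then show "fix_codim (u \<circ> ?t) \<le> fix_codim u + 1"
    using fix_codim_comp_le[OF lin linear_hyperplane_reflection[of v]]
      fix_codim_hyperplane_reflection_le[of v] by linarith
  have sub: "fix_space (u \<circ> ?t) \<subseteq> fix_space u \<inter> {x. v \<bullet> x = 0}"
  proof
    fix x assume "x \<in> fix_space (u \<circ> ?t)"
    then have x: "u (?t x) = x"
      by (simp add: fix_space_def)
    \<comment> \<open>The coordinate along \<open>e\<close> is kept by \<open>u\<close>, while
      \<open>?t x - x\<close> is a multiple of \<open>v\<close>, which is not orthogonal to
      \<open>e\<close>; so that multiple is zero.\<close>
    have "?t x \<bullet> e = u (?t x) \<bullet> u e"
      using u by (simp add: orthogonal_transformation_def)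
    also have "\<dots> = x \<bullet> e"
      by (simp add: x e)
    finally have "2 * (v \<bullet> x) / (v \<bullet> v) = 0"
      using v by (simp add: hyperplane_reflection_def inner_diff_left)
    then have "v \<bullet> x = 0"
      using \<open>v \<noteq> 0\<close> by simp
    then show "x \<in> fix_space u \<inter> {x. v \<bullet> x = 0}"
      using x by (simp add: hyperplane_reflection_fixes fix_space_def)
  qed
  \<comment> \<open>The vector \<open>e\<close> witnesses that the inclusion is strict, so the
    dimension drops.\<close>
  have "e \<in> fix_space u" "e \<notin> fix_space (u \<circ> ?t)"
    using sub v e by (auto simp: fix_space_def)
  then have "fix_space (u \<circ> ?t) \<subset> fix_space u"
    using sub by blast
  then have "dim (fix_space (u \<circ> ?t)) < dim (fix_space u)"
    using dim_psubset[of "fix_space (u \<circ> ?t)" "fix_space u"] lin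
    by (simp add: span_eq_iff[THEN iffD2] subspace_fix_space linear_compose linear_hyperplane_reflection)
  then show "fix_codim u + 1 \<le> fix_codim (u \<circ> ?t)"
    using fix_codim_add_dim[of u] fix_codim_add_dim[of "u \<circ> ?t"] by linarith
qed

section \<open>The absolute order as a product of claws\<close>

text \<open>Abstracts what types A and B share, so that the argument runs once. The root
  \<open>i - w i\<close> gives the reflection exchanging \<open>i\<close> and \<open>w i\<close>,
  which have equal norm.\<close>

locale basis_reflection_group =
  fixes W :: "('a::euclidean_space \<Rightarrow> 'a) set"
  assumes finite_W: "finite W"
    and orthogonal: "w \<in> W \<Longrightarrow> orthogonal_transformation w"
    and id_mem: "id \<in> W"
    and comp_mem: "u \<in> W \<Longrightarrow> w \<in> W \<Longrightarrow> u \<circ> w \<in> W"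
    and inv_mem: "w \<in> W \<Longrightarrow> inv w \<in> W"
    and reflection_mem: "i \<in> Basis \<Longrightarrow> w \<in> W \<Longrightarrow> w i \<noteq> i \<Longrightarrow> hyperplane_reflection (i - w i) \<in> W"
begin

lemma lin: "w \<in> W \<Longrightarrow> linear w"
  using orthogonal orthogonal_transformation_linear by blast

lemma bij: "w \<in> W \<Longrightarrow> bij w"
  using orthogonal orthogonal_transformation_bij by blast

lemma inv_comp_cancel: "w \<in> W \<Longrightarrow> inv w \<circ> w = id" "w \<in> W \<Longrightarrow> w \<circ> inv w = id"
  using bij by (auto simp: bij_is_inj bij_is_surj surj_iff[symmetric])

lemma comp_inv_cancel_left: "w \<in> W \<Longrightarrow> w \<circ> (inv w \<circ> u) = u"
  by (simp add: inv_comp_cancel flip: comp_assoc)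

text \<open>The vectors fixed are those outside \<open>S\<close>, so adding basis vectors to
  \<open>S\<close> one at a time climbs from \<open>{id}\<close> to \<open>W\<close>.\<close>

definition stabilizer :: "'a set \<Rightarrow> ('a \<Rightarrow> 'a) set" where
  "stabilizer S = {w \<in> W. \<forall>b\<in>Basis - S. w b = b}"

lemma stabilizer_subset: "stabilizer S \<subseteq> W"
  by (auto simp: stabilizer_def)

lemma stabilizer_empty: "stabilizer {} = {id}"
  using linear_eq_stdbasis[OF lin linear_id] id_mem by (auto simp: stabilizer_def)

lemma stabilizer_Basis: "stabilizer Basis = W"
  by (auto simp: stabilizer_def)

lemma stabilizer_comp: "u \<in> stabilizer S \<Longrightarrow> w \<in> stabilizer S \<Longrightarrow> u \<circ> w \<in> stabilizer S"
  by (auto simp: stabilizer_def comp_mem)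

lemma stabilizer_inv: "w \<in> stabilizer S \<Longrightarrow> inv w \<in> stabilizer S"
  by (auto simp: stabilizer_def inv_mem bij bij_is_inj inv_f_eq)

lemma stabilizer_mono: "S \<subseteq> T \<Longrightarrow> stabilizer S \<subseteq> stabilizer T"
  by (auto simp: stabilizer_def)

text \<open>These are the top elements of the claw contributed by \<open>i\<close>, whose bottom is
  \<open>i\<close> itself. In type B they may be negatives of basis vectors.\<close>

definition proper_orbit :: "'a \<Rightarrow> 'a set \<Rightarrow> 'a set" where
  "proper_orbit i S = (\<lambda>w. w i) ` stabilizer (insert i S) - {i}"

lemma finite_proper_orbit: "finite (proper_orbit i S)"
  using finite_subset[OF stabilizer_subset finite_W] by (simp add: proper_orbit_def)

context
  fixes i :: 'a and S :: "'a set"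
  assumes i: "i \<in> Basis" "i \<notin> S"
begin

text \<open>A basis vector \<open>c\<close> outside \<open>insert i S\<close> is orthogonal to
  \<open>i\<close>, and also to \<open>b = w i\<close> since \<open>w\<close> is orthogonal and
  fixes \<open>c\<close>; so the reflection fixes \<open>c\<close>. Were its root orthogonal to
  \<open>i\<close>, it would fix \<open>i\<close>, giving \<open>b = i\<close>.\<close>

lemma proper_orbit_reflection:
  assumes "b \<in> proper_orbit i S"
  shows "hyperplane_reflection (i - b) \<in> stabilizer (insert i S)"
    and "hyperplane_reflection (i - b) i = b"
    and "hyperplane_reflection (i - b) b = i"
    and "(i - b) \<bullet> i \<noteq> 0"
proof -
  obtain w where w: "w \<in> W" "\<And>c. c \<in> Basis - insert i S \<Longrightarrow> w c = c" "b = w i" "b \<noteq> i"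
    using assms by (auto simp: proper_orbit_def stabilizer_def)
  have inner: "w x \<bullet> w y = x \<bullet> y" for x y
    using orthogonal[OF w(1)] by (simp add: orthogonal_transformation_def)
  have norm: "norm i = norm b"
    using inner[of i i] by (simp add: w(3) norm_eq)
  have "hyperplane_reflection (i - b) c = c" if "c \<in> Basis - insert i S" for c
  proof (rule hyperplane_reflection_fixes)
    have "i \<bullet> c = 0"
      using that i by (auto simp: inner_Basis)
    then show "(i - b) \<bullet> c = 0"
      using inner[of i c] w(2)[OF that] by (simp add: w(3) inner_diff_left)
  qed
  then show "hyperplane_reflection (i - b) \<in> stabilizer (insert i S)"
    using reflection_mem[OF i(1) w(1)] w by (simp add: stabilizer_def)
  show swap: "hyperplane_reflection (i - b) i = b"
    using hyperplane_reflection_swap[OF norm] .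
  show "hyperplane_reflection (i - b) b = i"
    using fun_cong[OF hyperplane_reflection_involution[of "i - b"], of i] swap by simp
  show "(i - b) \<bullet> i \<noteq> 0"
    using swap w(4) by (auto simp: hyperplane_reflection_def)
qed

text \<open>\<open>b = i\<close> encodes the absence of a factor, since \<open>hyperplane_reflection 0 = id\<close>.\<close>

lemma bij_betw_stabilizer_insert:
  "bij_betw (\<lambda>(u, b). u \<circ> hyperplane_reflection (i - b))
     (stabilizer S \<times> insert i (proper_orbit i S)) (stabilizer (insert i S))"
\<comment> \<open>The reflection sends \<open>b\<close> to \<open>i\<close> and \<open>u\<close>
  fixes \<open>i\<close>, so \<open>b\<close> is read off as \<open>inv w i\<close>; composing with
  the involution once more recovers \<open>u\<close>.\<close>
proof (rule bij_betw_byWitness[where f' = "\<lambda>w. (w \<circ> hyperplane_reflection (i - inv w i), inv w i)"])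
  have fixes_i: "u i = i" if "u \<in> stabilizer S" for u
    using that i by (auto simp: stabilizer_def)
  have St_W: "u \<in> W" if "u \<in> stabilizer T" for u T
    using that by (auto simp: stabilizer_def)
  have refl_mem: "hyperplane_reflection (i - b) \<in> stabilizer (insert i S)"
    and refl_swap: "hyperplane_reflection (i - b) b = i"
    if "b \<in> insert i (proper_orbit i S)" for b
    using that proper_orbit_reflection(1,3)[of b] id_mem by (auto simp: stabilizer_def)
  have cancel: "(u \<circ> hyperplane_reflection v) \<circ> hyperplane_reflection v = u" for u :: "'a \<Rightarrow> 'a" and v
    by (simp add: comp_assoc hyperplane_reflection_involution)
  show "\<forall>a\<in>stabilizer S \<times> insert i (proper_orbit i S).
      (\<lambda>w. (w \<circ> hyperplane_reflection (i - inv w i), inv w i))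
        ((\<lambda>(u, b). u \<circ> hyperplane_reflection (i - b)) a) = a"
  proof
    fix x assume "x \<in> stabilizer S \<times> insert i (proper_orbit i S)"
    then obtain u b where x: "x = (u, b)"
        and ub: "u \<in> stabilizer S" "b \<in> insert i (proper_orbit i S)"
      by blast
    let ?w = "u \<circ> hyperplane_reflection (i - b)"
    have "?w \<in> W"
      using ub refl_mem by (auto intro: comp_mem St_W)
    moreover have "?w b = i"
      using refl_swap[OF ub(2)] fixes_i[OF ub(1)] by simp
    ultimately have "inv ?w i = b"
      using bij by (metis bij_inv_eq_iff)
    then show "(\<lambda>w. (w \<circ> hyperplane_reflection (i - inv w i), inv w i))
        ((\<lambda>(u, b). u \<circ> hyperplane_reflection (i - b)) x) = x"
      using cancel[of u "i - b"] by (simp add: x)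
  qed
  show "\<forall>w\<in>stabilizer (insert i S). (\<lambda>(u, b). u \<circ> hyperplane_reflection (i - b))
      ((\<lambda>w. (w \<circ> hyperplane_reflection (i - inv w i), inv w i)) w) = w"
    using cancel by simp
  show "(\<lambda>(u, b). u \<circ> hyperplane_reflection (i - b)) ` (stabilizer S \<times> insert i (proper_orbit i S))
      \<subseteq> stabilizer (insert i S)"
    using refl_mem stabilizer_comp subsetD[OF stabilizer_mono[OF subset_insertI[of S i]]] by auto
  show "(\<lambda>w. (w \<circ> hyperplane_reflection (i - inv w i), inv w i)) ` stabilizer (insert i S)
      \<subseteq> stabilizer S \<times> insert i (proper_orbit i S)"
  proof (rule image_subsetI)
    fix w assume w: "w \<in> stabilizer (insert i S)"
    then have orbit: "inv w i \<in> insert i (proper_orbit i S)"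
      using stabilizer_inv[OF w] by (auto simp: proper_orbit_def)
    let ?u = "w \<circ> hyperplane_reflection (i - inv w i)"
    have "?u \<in> stabilizer (insert i S)"
      using w orbit by (intro stabilizer_comp refl_mem)
    moreover have "?u i = i"
    proof -
      have "hyperplane_reflection (i - inv w i) i = inv w i"
        using orbit proper_orbit_reflection(2) by auto
      then show ?thesis
        using bij[OF St_W[OF w]] by (simp add: bij_is_surj surj_f_inv_f)
    qed
    ultimately have "?u \<in> stabilizer S"
      by (auto simp: stabilizer_def)
    with orbit show "(?u, inv w i) \<in> stabilizer S \<times> insert i (proper_orbit i S)"
      by blast
  qed
qed

text \<open>Since \<open>i\<close> lies outside \<open>S\<close>, it is fixed by \<open>u\<close>,
  and it serves as the direction \<open>e\<close> in
  \<open>fix_codim_comp_reflection\<close>.\<close>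

lemma fix_codim_stabilizer_insert:
  assumes "u \<in> stabilizer S" "b \<in> insert i (proper_orbit i S)"
  shows "fix_codim (u \<circ> hyperplane_reflection (i - b)) = fix_codim u + (if b = i then 0 else 1)"
proof (cases "b = i")
  case True
  then show ?thesis
    by simp
next
  case False
  then have "b \<in> proper_orbit i S"
    using assms by simp
  then show ?thesis
    using fix_codim_comp_reflection[OF orthogonal _ proper_orbit_reflection(4)] assms(1) i False
    by (auto simp: stabilizer_def)
qed

end

section \<open>Absolute length as codimension, and the grading\<close>

text \<open>Split off one factor per basis vector with \<open>bij_betw_stabilizer_insert\<close>.
  Each factor other than the identity is a reflection raising the codimension by one, so the
  collected factors form a word of the right length.\<close>

lemma ex_reflection_word:
  assumes "w \<in> W"
  shows "\<exists>ts. length ts = fix_codim w \<and> set ts \<subseteq> reflections W \<and> foldr (\<circ>) ts id = w"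
proof -
  have "\<forall>w\<in>stabilizer S. \<exists>ts. length ts = fix_codim w \<and> set ts \<subseteq> reflections W \<and> foldr (\<circ>) ts id = w"
    if "finite S" "S \<subseteq> Basis" for S
    using that
  proof (induction S)
    case empty
    then show ?case
      by (intro ballI exI[of _ "[]"]) (simp add: stabilizer_empty)
  next
    case (insert i S)
    then have i: "i \<in> Basis" "i \<notin> S"
      by auto
    show ?case
    proof
      fix w assume "w \<in> stabilizer (insert i S)"
      then obtain u b where ub: "u \<in> stabilizer S" "b \<in> insert i (proper_orbit i S)"
          and w: "w = u \<circ> hyperplane_reflection (i - b)"
        unfolding bij_betw_imp_surj_on[OF bij_betw_stabilizer_insert[OF i], symmetric] by auto
      obtain ts where ts: "length ts = fix_codim u" "set ts \<subseteq> reflections W" "foldr (\<circ>) ts id = u"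
        using insert ub by blast
      show "\<exists>ts. length ts = fix_codim w \<and> set ts \<subseteq> reflections W \<and> foldr (\<circ>) ts id = w"
      proof (cases "b = i")
        case True
        then have "w = u"
          by (simp add: w)
        then show ?thesis
          using ts by blast
      next
        case False
        then have b: "b \<in> proper_orbit i S"
          using ub by simp
        have "hyperplane_reflection (i - b) \<in> reflections W"
          using proper_orbit_reflection(1)[OF i b] False
          by (auto simp: reflections_def stabilizer_def intro!: exI[of _ "i - b"])
        \<comment> \<open>Appending a letter turns the starting value of the fold from
          \<open>id\<close> into that letter.\<close>
        moreover have "foldr (\<circ>) ts t = foldr (\<circ>) ts id \<circ> t" for t :: "'a \<Rightarrow> 'a"
          by (induction ts) (simp_all add: comp_assoc)
        then have "foldr (\<circ>) (ts @ [hyperplane_reflection (i - b)]) id = w"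
          by (simp add: w ts(3))
        ultimately show ?thesis
          using ts fix_codim_stabilizer_insert[OF i ub] False
          by (intro exI[of _ "ts @ [hyperplane_reflection (i - b)]"]) (simp add: w)
      qed
    qed
  qed
  then show ?thesis
    using assms finite_Basis stabilizer_Basis by blast
qed

text \<open>Subadditivity, with at most one per reflection, bounds word length from below;
  \<open>ex_reflection_word\<close> attains the bound.\<close>

lemma fix_codim_foldr_le:
  assumes "set ts \<subseteq> reflections W"
  shows "fix_codim (foldr (\<circ>) ts id) \<le> length ts \<and> foldr (\<circ>) ts id \<in> W"
  using assms
proof (induction ts)
  case Nil
  then show ?case
    by (simp add: id_mem id_mem[unfolded id_def])
next
  case (Cons t ts)
  define g where "g = foldr (\<circ>) ts id"
  have eq: "foldr (\<circ>) (t # ts) id = t \<circ> g"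
    by (simp add: g_def)
  have g: "fix_codim g \<le> length ts \<and> g \<in> W"
    unfolding g_def by (rule Cons.IH) (use Cons.prems in auto)
  have "t \<in> W" "fix_codim t \<le> 1"
    using Cons.prems fix_codim_hyperplane_reflection_le by (auto simp: reflections_def)
  then have "fix_codim (t \<circ> g) \<le> length (t # ts) \<and> t \<circ> g \<in> W"
    using g fix_codim_comp_le[OF lin lin, of t g] by (simp add: comp_mem)
  then show ?case
    by (simp only: eq)
qed

lemma absolute_length_eq_fix_codim:
  assumes "w \<in> W"
  shows "absolute_length W w = fix_codim w"
  unfolding absolute_length_def
  by (rule Least_equality) (use ex_reflection_word[OF assms] fix_codim_foldr_le in auto)

lemma absolute_order_iff:
  "(p, m) \<in> absolute_order W \<longleftrightarrow>
     p \<in> W \<and> m \<in> W \<and> fix_codim m = fix_codim p + fix_codim (inv p \<circ> m)"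
  by (auto simp: absolute_order_def absolute_length_eq_fix_codim comp_mem inv_mem)

text \<open>The two codimensions differ by that of \<open>inv p \<circ> m\<close>, which vanishes
  only for the identity.\<close>

lemma fix_codim_less:
  assumes "(p, m) \<in> absolute_order W" "p \<noteq> m"
  shows "fix_codim p < fix_codim m"
proof (rule ccontr)
  assume "\<not> fix_codim p < fix_codim m"
  with assms have "fix_codim (inv p \<circ> m) = 0" and pm: "p \<in> W" "m \<in> W"
    by (auto simp: absolute_order_iff)
  then have "inv p \<circ> m = id"
    using fix_codim_eq_0_iff lin comp_mem inv_mem by blast
  with assms(2) show False
    using comp_inv_cancel_left[OF pm(1), of m] by simp
qed

lemma partial_order_on_absolute_order: "partial_order_on W (absolute_order W)"
  unfolding partial_order_on_def preorder_on_def
proof (intro conjI)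
  show "absolute_order W \<subseteq> W \<times> W"
    by (auto simp: absolute_order_def)
  show "refl_on W (absolute_order W)"
    by (auto simp: refl_on_def absolute_order_iff inv_comp_cancel)
  show "trans (absolute_order W)"
  proof (rule transI)
    fix p m q assume pm: "(p, m) \<in> absolute_order W" and mq: "(m, q) \<in> absolute_order W"
    then have W: "p \<in> W" "m \<in> W" "q \<in> W"
      by (auto simp: absolute_order_iff)
    \<comment> \<open>Subadditivity through \<open>m\<close> bounds the codimension of
      \<open>inv p \<circ> q\<close> above by \<open>fix_codim q - fix_codim p\<close>;
      subadditivity for \<open>p \<circ> (inv p \<circ> q)\<close> gives the same bound from
      below.\<close>
    have "fix_codim ((inv p \<circ> m) \<circ> (inv m \<circ> q)) \<le> fix_codim (inv p \<circ> m) + fix_codim (inv m \<circ> q)"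
      using W by (intro fix_codim_comp_le lin comp_mem inv_mem)
    moreover have "(inv p \<circ> m) \<circ> (inv m \<circ> q) = inv p \<circ> q"
      using comp_inv_cancel_left[OF W(2), of q] by (simp add: comp_assoc)
    moreover have "fix_codim (p \<circ> (inv p \<circ> q)) \<le> fix_codim p + fix_codim (inv p \<circ> q)"
      using W by (intro fix_codim_comp_le lin comp_mem inv_mem)
    ultimately show "(p, q) \<in> absolute_order W"
      using pm mq W comp_inv_cancel_left[OF W(1), of q] by (auto simp: absolute_order_iff)
  qed
  show "antisym (absolute_order W)"
  proof (rule antisymI)
    fix x y assume "(x, y) \<in> absolute_order W" "(y, x) \<in> absolute_order W"
    then show "x = y"
      using fix_codim_less[of x y] fix_codim_less[of y x] by fastforce
  qed
qed

text \<open>Take a shortest reflection word for \<open>inv p \<circ> m\<close> and multiply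
  \<open>p\<close> by its first letter only. Hence covering relations raise the rank by exactly
  one.\<close>

lemma ex_between:
  assumes "(p, m) \<in> absolute_order W" "fix_codim m \<noteq> fix_codim p + 1" "p \<noteq> m"
  shows "\<exists>z. (p, z) \<in> absolute_order W \<and> (z, m) \<in> absolute_order W \<and> z \<noteq> p \<and> z \<noteq> m"
proof -
  have W: "p \<in> W" "m \<in> W" and len: "fix_codim m = fix_codim p + fix_codim (inv p \<circ> m)"
    using assms by (auto simp: absolute_order_iff)
  obtain ts where ts: "length ts = fix_codim (inv p \<circ> m)" "set ts \<subseteq> reflections W"
      "foldr (\<circ>) ts id = inv p \<circ> m"
    using ex_reflection_word[OF comp_mem[OF inv_mem[OF W(1)] W(2)]] by blast
  have "fix_codim (inv p \<circ> m) \<ge> 2"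
    using assms(2) fix_codim_less[OF assms(1,3)] len by linarith
  then have "length ts \<ge> 2"
    using ts(1) by simp
  then obtain t ts' where ts': "ts = t # ts'" "ts' \<noteq> []"
    by (cases ts) force+
  define g where "g = foldr (\<circ>) ts' id"
  have t: "t \<in> W" "fix_codim t \<le> 1"
    using ts(2) fix_codim_hyperplane_reflection_le by (auto simp: ts' reflections_def)
  have g: "g \<in> W" "fix_codim g \<le> length ts'"
    using fix_codim_foldr_le[of ts'] ts(2) by (auto simp: ts' g_def)
  have tg: "t \<circ> g = inv p \<circ> m"
    using ts(3) by (simp add: ts' g_def)
  define z where "z = p \<circ> t"
  have z: "z \<in> W"
    by (simp add: z_def W t comp_mem)
  have m: "z \<circ> g = m"
    using comp_inv_cancel_left[OF W(1), of m] tg by (simp add: z_def comp_assoc)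
  have z_inv: "inv p \<circ> z = t" "inv z \<circ> m = g"
    using inv_comp_cancel(1)[OF W(1)] inv_comp_cancel(1)[OF z]
    by (simp_all add: z_def m[unfolded z_def, symmetric] flip: comp_assoc)
  \<comment> \<open>The upper bounds add up to exactly \<open>fix_codim m\<close>, so all of them
    are equalities.\<close>
  have "fix_codim (p \<circ> t) \<le> fix_codim p + fix_codim t" "fix_codim (z \<circ> g) \<le> fix_codim z + fix_codim g"
    using W t g z by (auto intro: fix_codim_comp_le lin)
  then have "fix_codim z = fix_codim p + fix_codim t" "fix_codim m = fix_codim z + fix_codim g"
    "fix_codim t = 1" "fix_codim g = length ts'"
    using len ts(1) t(2) g(2) by (simp_all add: m ts'(1) flip: z_def)
  then show ?thesis
    using W z z_inv ts'(2) by (intro exI[of _ z]) (auto simp: absolute_order_iff)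
qed

lemma finite_graded_poset_absolute_order:
  "finite_graded_poset W (absolute_order W) (absolute_length W)"
  unfolding finite_graded_poset_def
proof (intro conjI ballI impI)
  fix x assume x: "x \<in> W" "\<forall>y. (y, x) \<in> absolute_order W \<longrightarrow> y = x"
  moreover have "(id, x) \<in> absolute_order W"
    using x id_mem by (simp add: absolute_order_iff)
  ultimately have "x = id"
    by blast
  then show "absolute_length W x = 0"
    using id_mem by (simp add: absolute_length_eq_fix_codim)
next
  fix x y assume "x \<in> W" "y \<in> W" "poset_covers (absolute_order W) x y"
  then show "absolute_length W y = absolute_length W x + 1"
    using ex_between[of x y] by (auto simp: poset_covers_def absolute_length_eq_fix_codim)
qed (use finite_W id_mem partial_order_on_absolute_order in auto)

section \<open>Levels of the stabilizers as levels of a claw product\<close>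

definition level :: "'a set \<Rightarrow> nat \<Rightarrow> ('a \<Rightarrow> 'a) set" where
  "level S k = {w \<in> stabilizer S. fix_codim w = k}"

lemma finite_level: "finite (level S k)"
  using finite_subset[OF stabilizer_subset finite_W] by (simp add: level_def)

lemma rank_level_eq_level: "rank_level W (absolute_length W) k = level Basis k"
  by (auto simp: rank_level_def level_def stabilizer_Basis absolute_length_eq_fix_codim)

text \<open>Written with \<open>+ 1\<close> on the left so that it is empty at \<open>k = 0\<close>,
  where truncated subtraction would give level 0 again.\<close>

definition level_below :: "'a set \<Rightarrow> nat \<Rightarrow> ('a \<Rightarrow> 'a) set" where
  "level_below S k = {w \<in> stabilizer S. fix_codim w + 1 = k}"

lemma level_below_simps [simp]: "level_below S 0 = {}" "level_below S (Suc k) = level S k"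
  by (auto simp: level_below_def level_def)

text \<open>The factorization respects rank: pairs with \<open>b = i\<close> keep the codimension of
  \<open>u\<close>, all others raise it by one.\<close>

lemma bij_betw_level_insert:
  assumes i: "i \<in> Basis" "i \<notin> S"
  shows "bij_betw (\<lambda>(u, b). u \<circ> hyperplane_reflection (i - b))
    (level S k \<times> {i} \<union> level_below S k \<times> proper_orbit i S) (level (insert i S) k)"
proof (rule bij_betw_subset[OF bij_betw_stabilizer_insert[OF i]])
  let ?g = "\<lambda>(u, b). u \<circ> hyperplane_reflection (i - b)"
  let ?X = "level S k \<times> {i} \<union> level_below S k \<times> proper_orbit i S"
  have X: "?X = {x \<in> stabilizer S \<times> insert i (proper_orbit i S). fix_codim (?g x) = k}"
  proof (intro set_eqI)
    fix x :: "('a \<Rightarrow> 'a) \<times> 'a"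
    obtain u b where x: "x = (u, b)"
      by (cases x)
    have "i \<notin> proper_orbit i S"
      by (simp add: proper_orbit_def)
    then show "x \<in> ?X \<longleftrightarrow> x \<in> {x \<in> stabilizer S \<times> insert i (proper_orbit i S). fix_codim (?g x) = k}"
      using fix_codim_stabilizer_insert[OF i, of u b]
      by (cases "b = i") (auto simp: x level_def level_below_def)
  qed
  then show "?X \<subseteq> stabilizer S \<times> insert i (proper_orbit i S)"
    by blast
  have image_filter: "h ` {x \<in> A. fix_codim (h x) = k} = {w \<in> h ` A. fix_codim w = k}"
    for h :: "('a \<Rightarrow> 'a) \<times> 'a \<Rightarrow> 'a \<Rightarrow> 'a" and A
    by blast
  show "?g ` ?X = level (insert i S) k"
    unfolding X image_filter bij_betw_imp_surj_on[OF bij_betw_stabilizer_insert[OF i]]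
    by (simp only: level_def)
qed

text \<open>In other words, adding \<open>i\<close> multiplies the rank generating polynomial by
  \<open>1 + e * t\<close>, where \<open>e = card (proper_orbit i S)\<close>.\<close>

lemma card_level_insert:
  assumes "i \<in> Basis" "i \<notin> S"
  shows "card (level (insert i S) k) = card (level S k) + card (proper_orbit i S) * card (level_below S k)"
proof -
  have "finite (level_below S k)"
    using finite_level by (cases k) auto
  then have "card (level S k \<times> {i} \<union> level_below S k \<times> proper_orbit i S)
      = card (level S k) + card (proper_orbit i S) * card (level_below S k)"
    using finite_level finite_proper_orbit
    by (subst card_Un_disjoint) (auto simp: card_cartesian_product proper_orbit_def)
  then show ?thesis
    using bij_betw_same_card[OF bij_betw_level_insert[OF assms]] by simp
qed

text \<open>The quotient \<open>inv (u \<circ> t) \<circ> (v \<circ> t)\<close> is a conjugate of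
  \<open>inv u \<circ> v\<close>, and both ends rise by the same \<open>c\<close>.\<close>

lemma absolute_order_comp_right:
  assumes "(u, v) \<in> absolute_order W" "t \<in> W"
    and "fix_codim (u \<circ> t) = fix_codim u + c" "fix_codim (v \<circ> t) = fix_codim v + c"
  shows "(u \<circ> t, v \<circ> t) \<in> absolute_order W"
proof -
  have W: "u \<in> W" "v \<in> W"
    using assms by (auto simp: absolute_order_iff)
  have "inv (u \<circ> t) \<circ> (v \<circ> t) = inv t \<circ> (inv u \<circ> v) \<circ> t"
    using W bij assms(2) by (simp add: o_inv_distrib comp_assoc)
  then have "fix_codim (inv (u \<circ> t) \<circ> (v \<circ> t)) = fix_codim (inv u \<circ> v)"
    using W assms(2) by (simp add: fix_codim_conj lin bij comp_mem inv_mem)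
  then show ?thesis
    using assms W by (simp add: absolute_order_iff comp_mem)
qed

text \<open>Composition sends every relation of the claw product into the absolute order. The latter
  may contain further relations, but a flow along some of them is enough.\<close>

lemma ex_normalized_flow_insert:
  assumes i: "i \<in> Basis" "i \<notin> S"
    and flow: "\<And>k. \<exists>f. normalized_flow (absolute_order W) (level S k) (level S (Suc k)) f"
    and log_concave: "\<And>k. card (level S k) * card (level S (Suc (Suc k))) \<le> card (level S (Suc k)) ^ 2"
    and empty: "\<And>k. level S k = {} \<Longrightarrow> level S (Suc k) = {}"
  shows "\<exists>f. normalized_flow (absolute_order W) (level (insert i S) k) (level (insert i S) (Suc k)) f"
proof -
  let ?g = "\<lambda>(u, b). u \<circ> hyperplane_reflection (i - b)"
  let ?O = "proper_orbit i S"
  have St: "u \<in> W" "u \<in> stabilizer S" if "u \<in> level S j \<or> u \<in> level_below S j" for u j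
    using that by (auto simp: level_def level_below_def stabilizer_def)
  have refl: "hyperplane_reflection (i - b) \<in> W" if "b \<in> ?O" for b
    using proper_orbit_reflection(1)[OF i that] by (simp add: stabilizer_def)
  have codim: "fix_codim (u \<circ> hyperplane_reflection (i - b)) = fix_codim u + 1"
    if "u \<in> stabilizer S" "b \<in> ?O" for u b
    using fix_codim_stabilizer_insert[OF i that(1), of b] that(2) by (auto simp: proper_orbit_def)
  obtain f' where f': "normalized_flow (absolute_order W) (level S k) (level S (Suc k)) f'"
    using flow by blast
  obtain f where f: "normalized_flow (absolute_order W) (level_below S k) (level S k) f"
  proof (cases k)
    case 0
    have "normalized_flow (absolute_order W) (level_below S k) (level S k) (\<lambda>_ _. 0)"
      by (simp add: 0 normalized_flow_def)
    then show ?thesis by (rule that)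
  next
    case (Suc j)
    with flow[of j] show ?thesis
      using that by auto
  qed
  \<comment> \<open>The relation on pairs is the absolute order pulled back along \<open>?g\<close>,
    which makes the later transport immediate.\<close>
  have "\<exists>F. normalized_flow {(x, y). (?g x, ?g y) \<in> absolute_order W}
      (level S k \<times> {i} \<union> level_below S k \<times> ?O)
      (level S (Suc k) \<times> {i} \<union> level S k \<times> ?O) F"
  proof (rule normalized_flow_claw_product[OF _ _ _ _ _ f f'])
    show "finite (level_below S k)"
      using finite_level by (cases k) auto
    show "card (level_below S k) * card (level S (Suc k)) \<le> card (level S k) ^ 2"
      using log_concave by (cases k) auto
  next
    fix u b assume "u \<in> level S k" "b \<in> ?O"
    moreover from this have "inv u \<circ> (u \<circ> hyperplane_reflection (i - b)) = hyperplane_reflection (i - b)"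
      using inv_comp_cancel(1)[OF St(1), of u k] by (simp flip: comp_assoc)
    moreover have "fix_codim (hyperplane_reflection (i - b)) = 1"
      using codim[of id b] \<open>b \<in> ?O\<close> id_mem by (simp add: stabilizer_def)
    ultimately show "((u, i), (u, b)) \<in> {(x, y). (?g x, ?g y) \<in> absolute_order W}"
      using codim[of u b] St[of u k] refl[of b] by (simp add: absolute_order_iff comp_mem)
  next
    fix u v b
    assume "u \<in> level_below S k" "v \<in> level S k" "b \<in> ?O" "(u, v) \<in> absolute_order W"
    then show "((u, b), (v, b)) \<in> {(x, y). (?g x, ?g y) \<in> absolute_order W}"
      using absolute_order_comp_right[of u v _ 1] codim refl St(1,2)[of u k] St(1,2)[of v k]
      by simp
  qed (use finite_level finite_proper_orbit empty in \<open>auto simp: proper_orbit_def\<close>)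
  then obtain F where F: "normalized_flow {(x, y). (?g x, ?g y) \<in> absolute_order W}
      (level S k \<times> {i} \<union> level_below S k \<times> ?O)
      (level S (Suc k) \<times> {i} \<union> level_below S (Suc k) \<times> ?O) F"
    by auto
  show ?thesis
    by (rule normalized_flow_transport[OF F bij_betw_level_insert[OF i] bij_betw_level_insert[OF i]]) auto
qed

text \<open>The properties are proved together because the flow step consumes the other two.
  Log-concavity without gaps survives multiplication of the rank polynomial by
  \<open>1 + e * t\<close>.\<close>

lemma level_properties:
  assumes "finite S" "S \<subseteq> Basis"
  shows "(\<exists>f. normalized_flow (absolute_order W) (level S k) (level S (Suc k)) f) \<and>
    card (level S k) * card (level S (Suc (Suc k))) \<le> card (level S (Suc k)) ^ 2 \<and>
    (level S k = {} \<longrightarrow> level S (Suc k) = {})"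
  using assms
proof (induction S arbitrary: k)
  case empty
  have "level {} (Suc j) = {}" for j
    by (auto simp: level_def stabilizer_empty)
  then show ?case
    by (auto simp: normalized_flow_def)
next
  case (insert i S)
  then have i: "i \<in> Basis" "i \<notin> S"
    by auto
  have IH: "\<exists>f. normalized_flow (absolute_order W) (level S k) (level S (Suc k)) f"
      "card (level S k) * card (level S (Suc (Suc k))) \<le> card (level S (Suc k)) ^ 2"
      "level S k = {} \<Longrightarrow> level S (Suc k) = {}" for k
    using insert by blast+
  note card = card_level_insert[OF i]
  define e where "e = card (proper_orbit i S)"
  have card_0: "card (level T j) = 0 \<longleftrightarrow> level T j = {}" for T j
    using finite_level by simp
  have "card (level (insert i S) k) * card (level (insert i S) (Suc (Suc k)))
      \<le> card (level (insert i S) (Suc k)) ^ 2"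
  proof (cases k)
    case 0
    \<comment> \<open>At rank 0 there is no second summand, since \<open>level_below S 0\<close> is
      empty.\<close>
    have "card (level S 0) * (card (level S 2) + e * card (level S 1))
        \<le> (card (level S 1) + e * card (level S 0)) ^ 2"
      using IH(2)[of 0] by (simp add: power2_eq_square algebra_simps numeral_2_eq_2)
    then show ?thesis
      by (simp add: 0 card e_def numeral_2_eq_2)
  next
    case (Suc j)
    define a0 a1 a2 a3 where "a0 = card (level S j)" and "a1 = card (level S (Suc j))"
      and "a2 = card (level S (Suc (Suc j)))" and "a3 = card (level S (Suc (Suc (Suc j))))"
    have lc: "a0 * a2 \<le> a1 ^ 2" "a1 * a3 \<le> a2 ^ 2"
      using IH(2) by (simp_all add: a0_def a1_def a2_def a3_def)
    \<comment> \<open>Multiply the two log-concavity inequalities and cancel \<open>a1 * a2\<close>;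
      if that is zero, the absence of gaps forces \<open>a3 = 0\<close>.\<close>
    have "a0 * a3 \<le> a1 * a2"
    proof (cases "a1 = 0 \<or> a2 = 0")
      case True
      then have "a3 = 0"
        using IH(3) by (auto simp: a1_def a2_def a3_def card_0)
      then show ?thesis by simp
    next
      case False
      have "(a0 * a3) * (a1 * a2) \<le> (a1 * a2) * (a1 * a2)"
        using mult_mono[OF lc] by (simp add: power2_eq_square ac_simps)
      then show ?thesis
        using False by simp
    qed
    then have "e * (a0 * a3) \<le> e * (a1 * a2)" "e * e * (a0 * a2) \<le> e * e * a1 ^ 2"
      using lc by simp_all
    moreover have "(a1 + e * a0) * (a3 + e * a2)
        = a1 * a3 + e * (a1 * a2) + e * (a0 * a3) + e * e * (a0 * a2)"
      by (simp add: algebra_simps)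
    moreover have "(a2 + e * a1) ^ 2 = a2 ^ 2 + 2 * (e * (a1 * a2)) + e * e * a1 ^ 2"
      by (simp add: power2_eq_square algebra_simps)
    ultimately have "(a1 + e * a0) * (a3 + e * a2) \<le> (a2 + e * a1) ^ 2"
      using lc by linarith
    then show ?thesis
      by (simp add: Suc card e_def a0_def a1_def a2_def a3_def)
  qed
  moreover have "level (insert i S) (Suc k) = {}" if "level (insert i S) k = {}"
    using that IH(3)[of k] by (simp add: card card_0 flip: card_0)
  moreover have "\<exists>f. normalized_flow (absolute_order W) (level (insert i S) k) (level (insert i S) (Suc k)) f"
  proof (rule ex_normalized_flow_insert[OF i])
    show "\<exists>f. normalized_flow (absolute_order W) (level S j) (level S (Suc j)) f" for j
      by (rule IH(1))
    show "card (level S j) * card (level S (Suc (Suc j))) \<le> card (level S (Suc j)) ^ 2" for j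
      by (rule IH(2))
    show "level S (Suc j) = {}" if "level S j = {}" for j
      using that by (rule IH(3))
  qed
  ultimately show ?case
    by (intro conjI impI)
qed

lemma strong_Sperner_absolute_order: "strong_Sperner W (absolute_order W) (absolute_length W)"
  unfolding strong_Sperner_def
proof (intro conjI ballI finite_graded_poset_absolute_order)
  let ?r = "poset_rank W (absolute_length W)"
  have props: "\<exists>f. normalized_flow (absolute_order W) (level Basis k) (level Basis (Suc k)) f"
    "level Basis k = {} \<Longrightarrow> level Basis (Suc k) = {}" for k
    using level_properties[OF finite_Basis subset_refl] by blast+
  have "?r \<in> absolute_length W ` W"
    unfolding poset_rank_def using finite_W id_mem by (intro Max_in) auto
  then have top: "level Basis ?r \<noteq> {}"
    by (auto simp: rank_level_def simp flip: rank_level_eq_level)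
  \<comment> \<open>Downwards from the top rank: an empty level would make the next one empty
    too.\<close>
  have nonempty: "level Basis j \<noteq> {}" if "j \<le> ?r" for j
    using that by (induction rule: inc_induct) (use top props(2) in blast)+
  fix k assume k: "k \<in> {1..?r + 1}"
  show "k_Sperner W (absolute_order W) (absolute_length W) k"
  proof (rule k_Sperner_if_normalized_flow[OF finite_W partial_order_on_absolute_order])
    fix x y assume xy: "(x, y) \<in> absolute_order W" "x \<noteq> y"
    then have "x \<in> W" "y \<in> W"
      by (simp_all add: absolute_order_iff)
    with fix_codim_less[OF xy] show "absolute_length W x < absolute_length W y"
      by (simp add: absolute_length_eq_fix_codim)
  next
    show "rank_level W (absolute_length W) j \<noteq> {}" if "j \<le> ?r" for j
      unfolding rank_level_eq_level by (rule nonempty[OF that])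
  next
    show "\<exists>f. normalized_flow (absolute_order W) (rank_level W (absolute_length W) j)
        (rank_level W (absolute_length W) (Suc j)) f" for j
      unfolding rank_level_eq_level by (rule props(1))
  qed (use k in auto)
qed

end


section \<open>Types A and B\<close>

text \<open>The root has squared norm 2, which cancels the factor 2 in the reflection.\<close>

lemma hyperplane_reflection_diff_Basis:
  assumes "i \<in> Basis" "b \<in> Basis" "i \<noteq> b" "\<bar>s\<bar> = 1"
  shows "hyperplane_reflection (i - s *\<^sub>R b) x = x - (x \<bullet> i - s * (x \<bullet> b)) *\<^sub>R (i - s *\<^sub>R b)"
proof -
  have "s * s = 1"
    using assms(4) by (metis abs_mult_self_eq mult_1)
  then show ?thesis
    using assms by (simp add: hyperplane_reflection_def inner_diff_left inner_diff_right inner_Basis inner_commute)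
qed

lemma image_eq_if_involution:
  assumes "f \<circ> f = id" "f ` S \<subseteq> S"
  shows "f ` S = S"
proof
  show "S \<subseteq> f ` S"
  proof
    fix x assume "x \<in> S"
    with assms have "f x \<in> S" "x = f (f x)"
      by (auto simp: fun_eq_iff)
    then show "x \<in> f ` S"
      by (rule rev_image_eqI)
  qed
qed (rule assms)

text \<open>A linear map is determined by its values on the basis, and these lie in the finite set
  \<open>V\<close>, so the group is finite. For reflections, mapping \<open>K\<close> into itself
  suffices because they are involutions.\<close>

lemma basis_reflection_group_symmetry_group:
  fixes K V :: "'a::euclidean_space set"
  assumes "finite V"
    and V: "\<And>w i. w \<in> symmetry_group K \<Longrightarrow> i \<in> Basis \<Longrightarrow> w i \<in> V"
    and refl: "\<And>i b. i \<in> Basis \<Longrightarrow> b \<in> V \<Longrightarrow> b \<noteq> i \<Longrightarrow> hyperplane_reflection (i - b) ` K \<subseteq> K"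
  shows "basis_reflection_group (symmetry_group K)"
proof
  let ?W = "symmetry_group K"
  have inj: "inj_on (\<lambda>w. restrict w Basis) ?W"
  proof (rule inj_onI)
    fix u w assume uw: "u \<in> ?W" "w \<in> ?W" and eq: "restrict u Basis = restrict w Basis"
    show "u = w"
    proof (rule linear_eq_stdbasis)
      show "u b = w b" if "b \<in> Basis" for b
        using fun_cong[OF eq, of b] that by simp
    qed (use uw in \<open>auto simp: symmetry_group_def orthogonal_transformation_linear\<close>)
  qed
  have "(\<lambda>w. restrict w Basis) ` ?W \<subseteq> Basis \<rightarrow>\<^sub>E V"
    using V by auto
  moreover have "finite (Basis \<rightarrow>\<^sub>E V)"
    using \<open>finite V\<close> by (intro finite_PiE) auto
  ultimately show "finite ?W"
    by (rule finite_imageD[OF finite_subset inj])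
next
  fix w assume w: "w \<in> symmetry_group K"
  then show "orthogonal_transformation w"
    by (simp add: symmetry_group_def)
  then have "inv w ` (w ` K) = K"
    by (simp add: image_inv_f_f orthogonal_transformation_inj)
  then show "inv w \<in> symmetry_group K"
    using w by (simp add: symmetry_group_def orthogonal_transformation_inv)
next
  fix i :: 'a and w assume "i \<in> Basis" "w \<in> symmetry_group K" "w i \<noteq> i"
  then show "hyperplane_reflection (i - w i) \<in> symmetry_group K"
    using refl V by (simp add: symmetry_group_def orthogonal_transformation_hyperplane_reflection
        image_eq_if_involution[OF hyperplane_reflection_involution])
next
  fix u w assume "u \<in> symmetry_group K" "w \<in> symmetry_group K"
  then show "u \<circ> w \<in> symmetry_group K"
    using image_comp[of u w K] by (simp add: symmetry_group_def orthogonal_transformation_compose)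
qed (simp add: symmetry_group_def id_def)

text \<open>By affine independence the basis vectors are exactly the extreme points of the simplex,
  and injective linear symmetries permute those. The reflection in \<open>i - b\<close> exchanges
  two basis vectors and fixes the rest.\<close>

lemma basis_reflection_group_coxeter_A:
  "basis_reflection_group (coxeter_A :: (real ^ 'n \<Rightarrow> real ^ 'n) set)"
  unfolding coxeter_A_def
proof (rule basis_reflection_group_symmetry_group[OF finite_Basis])
  let ?K = "convex hull (Basis :: (real ^ 'n) set)"
  have vertex: "{x} face_of ?K \<longleftrightarrow> x \<in> Basis" for x
    using extreme_point_of_convex_hull_affine_independent[of Basis x] independent_Basis
      affine_dependent_imp_dependent by (auto simp: face_of_singleton)
  show "w i \<in> Basis" if "w \<in> symmetry_group ?K" "i \<in> Basis" for w i
  proof -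
    have "{i} face_of ?K"
      using that vertex by simp
    then have "w ` {i} face_of w ` ?K"
      using that face_of_linear_image[of w "{i}" ?K]
      by (simp only: symmetry_group_def mem_Collect_eq orthogonal_transformation_linear orthogonal_transformation_inj)
    then show ?thesis
      using that vertex by (simp add: symmetry_group_def)
  qed
next
  fix i b :: "real ^ 'n" assume ib: "i \<in> Basis" "b \<in> Basis" "b \<noteq> i"
  let ?t = "hyperplane_reflection (i - b)"
  have "?t x \<in> Basis" if "x \<in> Basis" for x
    using that ib hyperplane_reflection_diff_Basis[of i b 1 x] by (auto simp: inner_Basis)
  then show "?t ` (convex hull Basis) \<subseteq> convex hull Basis"
    by (subst convex_hull_linear_image[OF linear_hyperplane_reflection]) (auto intro!: hull_mono)
qed

text \<open>A symmetry of the cube maps \<open>2 e\<^sub>i\<close>, a difference of two vertices, to a difference of two vertices.\<close>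

lemma cube_symmetry_axis:
  fixes w :: "real ^ 'n \<Rightarrow> real ^ 'n"
  assumes w: "w \<in> symmetry_group {x. \<forall>i. x $ i \<in> {-1..1}}" and i: "i \<in> Basis"
  shows "w i \<in> Basis \<union> uminus ` Basis"
proof -
  let ?K = "{x :: real ^ 'n. \<forall>i. x $ i \<in> {-1..1}}"
  have orth: "orthogonal_transformation w" and K: "w ` ?K = ?K"
    using w by (auto simp: symmetry_group_def)
  \<comment> \<open>The coordinates of \<open>w v\<close> have absolute value at most one, yet
    \<open>w v\<close> has the same norm as the vertex \<open>v\<close>; so every bound is
    attained.\<close>
  have vertex: "(w v $ j)\<^sup>2 = 1" if v: "\<And>j. \<bar>v $ j\<bar> = 1" for v j
  proof -
    have le: "(w v $ k)\<^sup>2 \<le> 1" for k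
    proof -
      have "-1 \<le> v $ l \<and> v $ l \<le> 1" for l
        using v[of l] by linarith
      then have "v \<in> ?K"
        by simp
      then have "w v \<in> ?K"
        using K by blast
      then show ?thesis
        by (auto simp: abs_square_le_1 abs_le_iff minus_le_iff)
    qed
    have "w v \<bullet> w v = v \<bullet> v"
      using orth by (simp add: orthogonal_transformation_def)
    moreover have "(v $ k)\<^sup>2 = 1" for k
      using v[of k] by (simp add: abs_square_eq_1)
    ultimately have "(\<Sum>k\<in>UNIV. 1 - (w v $ k)\<^sup>2) = 0"
      by (simp add: inner_vec_def power2_eq_square sum_subtractf)
    then have "\<forall>k\<in>UNIV. 1 - (w v $ k)\<^sup>2 = 0"
      using le by (subst (asm) sum_nonneg_eq_0_iff) auto
    then show ?thesis by simp
  qed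
  obtain a where a: "i = axis a 1"
    using i by (auto simp: Basis_vec_def)
  define u v :: "real ^ 'n" where "u = (\<chi> j. 1)" and "v = (\<chi> j. if j = a then -1 else 1)"
  have "u - v = 2 *\<^sub>R i"
    by (simp add: vec_eq_iff u_def v_def a axis_def)
  then have "w (u - v) = w (2 *\<^sub>R i)"
    by (rule arg_cong)
  then have "w u - w v = 2 *\<^sub>R w i"
    using orthogonal_transformation_linear[OF orth] by (simp only: linear_diff linear_scale)
  then have "(w u - w v) $ j = (2 *\<^sub>R w i) $ j" for j
    by (rule arg_cong)
  then have diff: "w u $ j - w v $ j = 2 * w i $ j" for j
    by simp
  have coords: "w i $ j \<in> {-1, 0, 1}" for j
  proof -
    have "w u $ j = 1 \<or> w u $ j = -1" "w v $ j = 1 \<or> w v $ j = -1"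
      using vertex[of u j] vertex[of v j] by (simp_all add: u_def v_def power2_eq_1_iff)
    then show ?thesis
      using diff[of j] by auto
  qed
  have "w i \<bullet> w i = 1"
    using orth i by (simp add: orthogonal_transformation_def)
  then have sum: "(\<Sum>j\<in>UNIV. (w i $ j)\<^sup>2) = 1"
    by (simp add: inner_vec_def power2_eq_square)
  obtain k where k: "w i $ k \<noteq> 0"
  proof (rule ccontr)
    assume "\<not> thesis"
    then have "w i $ j = 0" for j
      using that by blast
    with sum show False
      by simp
  qed
  then have k1: "w i $ k = 1 \<or> w i $ k = -1"
    using coords[of k] by auto
  \<comment> \<open>The single coordinate \<open>k\<close> already uses up the unit norm of
    \<open>w i\<close>.\<close>
  have "(\<Sum>j\<in>UNIV - {k}. (w i $ j)\<^sup>2) = 0"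
    using sum k1 by (subst (asm) sum.remove[of UNIV k]) auto
  then have "w i $ j = 0" if "j \<noteq> k" for j
    using that by (subst (asm) sum_nonneg_eq_0_iff) auto
  then have "w i = axis k 1 \<or> w i = - axis k 1"
    using k1 by (auto simp: vec_eq_iff axis_def)
  then show ?thesis
    by (auto simp: axis_in_Basis_iff)
qed

text \<open>For \<open>b = - i\<close> the reflection negates one coordinate; otherwise it exchanges
  two coordinates up to a common sign. Either way the cube is preserved.\<close>

lemma basis_reflection_group_coxeter_B:
  "basis_reflection_group (coxeter_B :: (real ^ 'n \<Rightarrow> real ^ 'n) set)"
  unfolding coxeter_B_def
proof (rule basis_reflection_group_symmetry_group[where V = "Basis \<union> uminus ` Basis"])
  fix i b :: "real ^ 'n" assume i: "i \<in> Basis" and b: "b \<in> Basis \<union> uminus ` Basis" "b \<noteq> i"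
  let ?K = "{x :: real ^ 'n. \<forall>i. x $ i \<in> {-1..1}}"
  obtain a where a: "i = axis a 1"
    using i by (auto simp: Basis_vec_def)
  obtain s c where c: "b = s *\<^sub>R axis c 1" "\<bar>s\<bar> = (1::real)"
  proof -
    consider c where "b = axis c 1" | c where "b = - axis c 1"
      using b(1) by (auto simp: Basis_vec_def)
    then show ?thesis
    proof cases
      case (1 c)
      then show ?thesis
        using that[of 1 c] by simp
    next
      case (2 c)
      then show ?thesis
        using that[of "-1" c] by simp
    qed
  qed
  show "hyperplane_reflection (i - b) ` ?K \<subseteq> ?K"
  proof (cases "c = a")
    case True
    \<comment> \<open>As \<open>b\<close> differs from \<open>i\<close>, the sign \<open>s\<close>
      must be negative here.\<close>
    then have "i - b = 2 *\<^sub>R axis a 1"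
      using b(2) c by (auto simp: a abs_if scaleR_2 split: if_splits)
    then have "hyperplane_reflection (i - b) x = x - (2 * x $ a) *\<^sub>R axis a 1" for x
      by (simp add: hyperplane_reflection_def inner_axis' inner_axis_axis)
    then have "hyperplane_reflection (i - b) x $ j = (if j = a then - x $ j else x $ j)" for x j
      by (simp add: axis_def)
    then show ?thesis
      by auto
  next
    case False
    have "hyperplane_reflection (i - b) x $ j
        = (if j = a then s * x $ c else if j = c then s * x $ a else x $ j)" for x j
    proof -
      have "s * s = 1"
        using c(2) by (metis abs_mult_self_eq mult_1)
      have refl: "hyperplane_reflection (i - b) x = x - (x $ a - s * x $ c) *\<^sub>R (axis a 1 - s *\<^sub>R axis c 1)"
        using hyperplane_reflection_diff_Basis[of "axis a 1" "axis c 1" s x] False c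
        by (simp add: a axis_in_Basis_iff axis_eq_axis inner_axis)
      have "s * (s * y) = y" for y
        using \<open>s * s = 1\<close> by (simp flip: mult.assoc)
      then show ?thesis
        unfolding refl using False by (auto simp: axis_def algebra_simps)
    qed
    moreover have "s = 1 \<or> s = -1"
      using c(2) by (auto simp: abs_if split: if_splits)
    ultimately show ?thesis
      by (auto simp: minus_le_iff)
  qed
qed (use cube_symmetry_axis in auto)

theorem theorem6p1:
  fixes n :: nat
  assumes "n \<ge> 1"
    and "CARD('a::finite) = n + 1"
    and "CARD('b::finite) = n"
  shows "strong_Sperner (coxeter_A :: (real ^ 'a \<Rightarrow> real ^ 'a) set)
           (absolute_order coxeter_A) (absolute_length coxeter_A)
       \<and> strong_Sperner (coxeter_B :: (real ^ 'b \<Rightarrow> real ^ 'b) set)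
           (absolute_order coxeter_B) (absolute_length coxeter_B)"
  by (intro conjI basis_reflection_group.strong_Sperner_absolute_order
      basis_reflection_group_coxeter_A basis_reflection_group_coxeter_B)

end
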